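(* For a sequential rectifiable $T_0$-space $X$ the following conditions are equivalent: (1) $X$ is a $\mathfrak P_0$-space; (2) $X$ is an $\aleph_0$-space; (3) $X$ is Lindelöf and has countable $\mathrm{cs}^*$-character; (4) $X$ is separable and has the strong Pytkeev property; (5) $X$ is either metrizable separable or a submetrizable $k_\omega$-space.
   Context: "Regular" means $T_3$. A topological space $X$ is rectifiable if there is a point $e\in X$ and a homeomorphism $H:X\times X\to X\times X$ such that $H(x,e)=(x,x)$ and $H(\{x\}\times X)=\{x\}\times X$ for every $x\in X$. A topological space $X$ is sequential if for each non-closed subset $A\subset X$ there is a sequence in $A$ convergent to some point of $X\setminus A$. A subset $A$ of a topological space $X$ accumulates at a point $x\in X$ if each neighborhood of $x$ contains infinitely many points of $A$. A family $\mathcal N$ of subsets of $X$ is a network at $x\in X$ if for any neighborhood $O_x$ of $x$ there is $N\in\mathcal N$ with $x\in N\subset O_x$. It is a Pytkeev network at $x$ if it is a network at $x$ and for each neighborhood $O_x$ of $x$ and each subset $A\subset X$ accumulating at $x$ there is $N\in\mathcal N$ such that $N\subset O_x$ and $N\cap A$ is infinite. It is a Pytkeev network for $X$ if it is a Pytkeev network at each point. A $\mathfrak P_0$-space is a regular space with a countable Pytkeev network. A space $X$ has the strong Pytkeev property if it has a countable Pytkeev network at each point $x\in X$. A family $\mathcal N$ of subsets of $X$ is a $k$-network if for each open set $U\subset X$ and each compact subset $K\subset U$ there is a finite subfamily $\mathcal F\subset\mathcal N$ such that $K\subset\bigcup\mathcal F\subset U$. An $\aleph_0$-space is a regular space with a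 countable $k$-network. A family $\mathcal N$ of subsets of $X$ is a $\mathrm{cs}^*$-network at $x$ if for each sequence $(x_n)_{n\in\omega}$ in $X$ convergent to $x$ and each neighborhood $O_x$ of $x$ there is $N\in\mathcal N$ such that $N\subset O_x$ and $\{n\in\omega:x_n\in N\}$ is infinite. A space $X$ has countable $\mathrm{cs}^*$-character if it has a countable $\mathrm{cs}^*$-network at each point $x\in X$. A topological space $X$ is submetrizable if it admits a continuous metric. A topological space $X$ is a $k_\omega$-space if it has a countable cover $\mathcal C$ by compact subsets such that a subset $U\subset X$ is open in $X$ if and only if $C\cap U$ is open in $C$ for every $C\in\mathcal C$. *)

theory Defs
  imports "HOL-Analysis.Analysis"
begin

(* Spaces are abstract topologies on a carrier topspace X.  Neighborhoods of a
   point are open sets containing it.  In this theory a regular space is T3: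
   the library's regular_space does not include any point separation. *)

definition T3_space :: "'a topology \<Rightarrow> bool" where
  "T3_space X \<longleftrightarrow> regular_space X \<and> t1_space X"

definition rectifiable_space :: "'a topology \<Rightarrow> bool" where
  "rectifiable_space X \<longleftrightarrow>
     (\<exists>e \<in> topspace X. \<exists>H. homeomorphic_map (prod_topology X X) (prod_topology X X) H \<and>
        (\<forall>x \<in> topspace X. H (x, e) = (x, x) \<and> H ` ({x} \<times> topspace X) = {x} \<times> topspace X))"

definition sequential_space :: "'a topology \<Rightarrow> bool" where
  "sequential_space X \<longleftrightarrow>
     (\<forall>A. A \<subseteq> topspace X \<and> \<not> closedin X A \<longrightarrow>
        (\<exists>s x. (\<forall>n::nat. s n \<in> A) \<and> x \<in> topspace X - A \<and> limitin X s x sequentially))"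

(* Infinitely many points are required, so outside T1 spaces this differs from
   membership in the library's derived set. *)
definition accumulates_at :: "'a topology \<Rightarrow> 'a set \<Rightarrow> 'a \<Rightarrow> bool" where
  "accumulates_at X A x \<longleftrightarrow> (\<forall>U. openin X U \<and> x \<in> U \<longrightarrow> infinite (U \<inter> A))"

definition network_at :: "'a topology \<Rightarrow> 'a set set \<Rightarrow> 'a \<Rightarrow> bool" where
  "network_at X \<N> x \<longleftrightarrow>
     \<N> \<subseteq> Pow (topspace X) \<and>
     (\<forall>U. openin X U \<and> x \<in> U \<longrightarrow> (\<exists>N \<in> \<N>. x \<in> N \<and> N \<subseteq> U))"

definition Pytkeev_network_at :: "'a topology \<Rightarrow> 'a set set \<Rightarrow> 'a \<Rightarrow> bool" where
  "Pytkeev_network_at X \<N> x \<longleftrightarrow>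
     network_at X \<N> x \<and>
     (\<forall>U A. openin X U \<and> x \<in> U \<and> A \<subseteq> topspace X \<and> accumulates_at X A x \<longrightarrow>
        (\<exists>N \<in> \<N>. N \<subseteq> U \<and> infinite (N \<inter> A)))"

definition Pytkeev_network :: "'a topology \<Rightarrow> 'a set set \<Rightarrow> bool" where
  "Pytkeev_network X \<N> \<longleftrightarrow>
     \<N> \<subseteq> Pow (topspace X) \<and> (\<forall>x \<in> topspace X. Pytkeev_network_at X \<N> x)"

definition P0_space :: "'a topology \<Rightarrow> bool" where
  "P0_space X \<longleftrightarrow> T3_space X \<and> (\<exists>\<N>. countable \<N> \<and> Pytkeev_network X \<N>)"

definition strong_Pytkeev_property :: "'a topology \<Rightarrow> bool" where
  "strong_Pytkeev_property X \<longleftrightarrow>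
     (\<forall>x \<in> topspace X. \<exists>\<N>. countable \<N> \<and> Pytkeev_network_at X \<N> x)"

definition k_network :: "'a topology \<Rightarrow> 'a set set \<Rightarrow> bool" where
  "k_network X \<N> \<longleftrightarrow>
     \<N> \<subseteq> Pow (topspace X) \<and>
     (\<forall>U K. openin X U \<and> compactin X K \<and> K \<subseteq> U \<longrightarrow>
        (\<exists>\<F>. finite \<F> \<and> \<F> \<subseteq> \<N> \<and> K \<subseteq> \<Union>\<F> \<and> \<Union>\<F> \<subseteq> U))"

definition aleph0_space :: "'a topology \<Rightarrow> bool" where
  "aleph0_space X \<longleftrightarrow> T3_space X \<and> (\<exists>\<N>. countable \<N> \<and> k_network X \<N>)"

definition cs_star_network_at :: "'a topology \<Rightarrow> 'a set set \<Rightarrow> 'a \<Rightarrow> bool" where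
  "cs_star_network_at X \<N> x \<longleftrightarrow>
     \<N> \<subseteq> Pow (topspace X) \<and>
     (\<forall>s U. (\<forall>n::nat. s n \<in> topspace X) \<and> limitin X s x sequentially \<and>
        openin X U \<and> x \<in> U \<longrightarrow>
        (\<exists>N \<in> \<N>. N \<subseteq> U \<and> infinite {n. s n \<in> N}))"

definition countable_cs_star_character :: "'a topology \<Rightarrow> bool" where
  "countable_cs_star_character X \<longleftrightarrow>
     (\<forall>x \<in> topspace X. \<exists>\<N>. countable \<N> \<and> cs_star_network_at X \<N> x)"

(* The metric need only be continuous, it need not generate the topology. *)
definition submetrizable_space :: "'a topology \<Rightarrow> bool" where
  "submetrizable_space X \<longleftrightarrow>
     (\<exists>d. Metric_space (topspace X) d \<and>
        continuous_map (prod_topology X X) euclideanreal (\<lambda>(x, y). d x y))"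

definition k_omega_space :: "'a topology \<Rightarrow> bool" where
  "k_omega_space X \<longleftrightarrow>
     (\<exists>\<C>. countable \<C> \<and> (\<forall>C \<in> \<C>. compactin X C) \<and> \<Union>\<C> = topspace X \<and>
        (\<forall>U. U \<subseteq> topspace X \<longrightarrow>
           (openin X U \<longleftrightarrow> (\<forall>C \<in> \<C>. openin (subtopology X C) (C \<inter> U)))))"

end

theory Submission
  imports Defs
begin

text \<open>
  Let \<open>e\<close> be the base point of a rectification. Its homeomorphism \<open>H\<close> has the form
  \<open>H (x, y) = (x, x \<cdot> y)\<close>, and its inverse has the form \<open>(x, y) \<mapsto> (x, ldiv x y)\<close>. Thus both operations
  are continuous, \<open>x \<cdot> e = x\<close>, \<open>ldiv x x = e\<close>, and each \<open>y \<mapsto> x \<cdot> y\<close> is a homeomorphism with inverse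
  \<open>y \<mapsto> ldiv x y\<close>. These operations replace the multiplication and the left division of a topological
  group; there is no right division, and this asymmetry decides the order of the factors below.
  They make the space regular, so \<open>T\<^sub>0\<close> gives \<open>T\<^sub>3\<close>, and they move questions about any point to \<open>e\<close>.

  The elementary implications hold in all regular Hausdorff spaces: a countable Pytkeev network is a
  \<open>k\<close>-network, a countable \<open>k\<close>-network is a network and a \<open>cs\<^sup>*\<close>-network, and a Pytkeev network at a
  point is a \<open>cs\<^sup>*\<close>-network there. If \<open>D\<close> is dense and \<open>\<N>\<close> is a countable Pytkeev network at \<open>e\<close>,
  then the sets \<open>d \<cdot> N\<close> form a network, because \<open>{ldiv d x | d \<in> D}\<close> accumulates at \<open>e\<close>; so a separable
  space with the strong Pytkeev property is Lindelof.

  The heart of the matter is that a Lindelof space of countable \<open>cs\<^sup>*\<close>-character is metrizable or a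
  submetrizable \<open>k\<^sub>\<omega>\<close>-space (lemma \<open>Lindelof_cs_star_dichotomy\<close>). Take a countable \<open>cs\<^sup>*\<close>-network at
  \<open>e\<close> made of closed sets and close it under finite unions and intersections.

  If its sequentially compact members capture all sequences converging to \<open>e\<close>, then the iterated
  products of these members form an open set, and countably many translates of it cover the space
  (lemma \<open>capturing_family\<close>). The translated products are countably many compact sets which capture
  every convergent sequence, and since the space is sequential they determine its topology. Every such
  set has a countable network by a total boundedness argument (lemma \<open>seq_compactin_network\<close>), so the
  whole space has one, and Urysohn functions for pairs of network elements define a continuous metric.

  Otherwise some sequence is trapped only by sets that are not sequentially compact, and these contain
  a metric fan: rows \<open>a k\<close> without convergent subsequences which shrink to \<open>e\<close> as \<open>k\<close> grows. Given
  sequences \<open>s n\<close> converging to \<open>e\<close>, the set of suitable products \<open>a n j \<cdot> s n m\<close> has \<open>e\<close> in its closure,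
  and sequentiality forces some \<open>s (g i) (h i)\<close> with \<open>g i \<longrightarrow> \<infinity>\<close> to converge: the closed copies
  of the metric fan and of the Frechet-Urysohn fan cannot coexist (lemma
  \<open>metric_fan_imp_crossing_property\<close>). This crossing property yields
  a countable family of sets trapping each sequence that converges to \<open>e\<close>, then a countable base at
  \<open>e\<close> (lemma \<open>crossing_imp_nbhd_base\<close>), and with the Lindelof property a countable base of the space.

  Conversely, a countable base is a Pytkeev network, and in a submetrizable \<open>k\<^sub>\<omega>\<close>-space the countable
  bases of the compact pieces together form one (lemma \<open>submetrizable_k_omega_imp_P0\<close>). This closes
  the cycle.
\<close>

section \<open>Sequences and sequential spaces\<close>

lemma limitin_reindex:
  assumes "filterlim r sequentially F" "limitin X s x sequentially"
  shows "limitin X (\<lambda>i. s (r i)) x F"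
  using assms by (auto simp: limitin_def dest: eventually_compose_filterlim)

lemma subsequence_frequently:
  fixes P :: "nat \<Rightarrow> nat \<Rightarrow> bool"
  assumes "\<And>n. \<exists>\<^sub>F k in sequentially. P n k"
  shows "\<exists>r::nat \<Rightarrow> nat. strict_mono r \<and> (\<forall>n. P n (r n))"
proof -
  have ex: "\<exists>k\<ge>m. P n k" for n m
    using assms[of n] by (auto simp: frequently_sequentially)
  have "\<exists>r. \<forall>n. P n (r n) \<and> r n < r (Suc n)"
  proof (rule dependent_nat_choice)
    show "\<exists>x. P 0 x" using ex by blast
    show "\<exists>y. P (Suc n) y \<and> x < y" for x n using ex[of "Suc x" "Suc n"] by auto
  qed
  then show ?thesis by (auto simp: strict_mono_Suc_iff)
qed

lemma nat_seq_dichotomy: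
  fixes f :: "nat \<Rightarrow> nat"
  shows "filterlim f at_top sequentially \<or> (\<exists>n r. strict_mono (r :: nat \<Rightarrow> nat) \<and> (\<forall>i. f (r i) = n))"
proof (cases "\<exists>n. infinite {i. f i = n}")
  case True
  then obtain n where "infinite {i. f i = n}" by blast
  from infinite_enumerate[OF this] show ?thesis by auto
next
  case False
  have "eventually (\<lambda>i. N \<le> f i) sequentially" for N
  proof -
    have "finite (\<Union>n<N. {i. f i = n})" using False by auto
    moreover have "(\<Union>n<N. {i. f i = n}) = {i. \<not> N \<le> f i}" by auto
    ultimately show ?thesis by (simp add: eventually_cofinite flip: cofinite_eq_sequentially)
  qed
  then show ?thesis by (simp add: filterlim_at_top)
qed

lemma regular_space_closure_subset:
  assumes "regular_space X" "openin X U" "x \<in> U"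
  obtains V where "openin X V" "x \<in> V" "X closure_of V \<subseteq> U"
proof -
  have "closedin X (topspace X - U)" "x \<in> topspace X - (topspace X - U)"
    using assms openin_subset by fastforce+
  with assms(1) obtain V where "openin X V" "x \<in> V" "disjnt (topspace X - U) (X closure_of V)"
    unfolding regular_space by meson
  then show ?thesis
    using that[of V] closure_of_subset_topspace[of X V] by (auto simp: disjnt_iff)
qed

lemma sequential_space_closedI:
  assumes "sequential_space X" "A \<subseteq> topspace X"
    and "\<And>s x. \<lbrakk>\<And>n::nat. s n \<in> A; limitin X s x sequentially\<rbrakk> \<Longrightarrow> x \<in> A"
  shows "closedin X A"
  using assms unfolding sequential_space_def by blast

lemma sequential_space_openI:
  assumes "sequential_space X" "U \<subseteq> topspace X"
    and "\<And>s x. \<lbrakk>x \<in> U; limitin X s x sequentially\<rbrakk> \<Longrightarrow> \<exists>n::nat. s n \<in> U"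
  shows "openin X U"
proof -
  have "closedin X (topspace X - U)"
    by (rule sequential_space_closedI[OF assms(1)])
       (use assms(3) limitin_topspace in \<open>fastforce+\<close>)
  then show ?thesis using assms(2) by (simp add: openin_closedin_eq)
qed

definition seq_compactin :: "'a topology \<Rightarrow> 'a set \<Rightarrow> bool" where
  "seq_compactin X K \<longleftrightarrow> K \<subseteq> topspace X \<and>
     (\<forall>d. (\<forall>n::nat. d n \<in> K) \<longrightarrow>
        (\<exists>r x. strict_mono r \<and> x \<in> K \<and> limitin X (\<lambda>n. d (r n)) x sequentially))"

text \<open>
  The index map \<open>r\<close> need only tend to infinity, not increase strictly: index maps that come out of an
  existence argument then apply directly.
\<close>

definition no_convergent_subsequence :: "'a topology \<Rightarrow> (nat \<Rightarrow> 'a) \<Rightarrow> bool" where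
  "no_convergent_subsequence X a \<longleftrightarrow>
     (\<forall>r x. filterlim r at_top sequentially \<longrightarrow> \<not> limitin X (\<lambda>i. a (r i)) x sequentially)"

lemma no_convergent_subsequenceD:
  "\<lbrakk>no_convergent_subsequence X a; filterlim r at_top sequentially\<rbrakk>
    \<Longrightarrow> \<not> limitin X (\<lambda>i. a (r i)) x sequentially"
  unfolding no_convergent_subsequence_def by simp

lemma filterlim_imp_strict_mono_subsequence:
  fixes r :: "nat \<Rightarrow> nat"
  assumes "filterlim r at_top sequentially"
  shows "\<exists>q::nat \<Rightarrow> nat. strict_mono q \<and> strict_mono (r \<circ> q)"
proof -
  have ex: "\<exists>k>m. r k > n" for n m
  proof -
    have "eventually (\<lambda>k. Suc n \<le> r k) sequentially"
      using assms by (simp add: filterlim_at_top)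
    then have "eventually (\<lambda>k. m < k \<and> Suc n \<le> r k) sequentially"
      using eventually_gt_at_top[of m] by (simp add: eventually_conj)
    then show ?thesis unfolding eventually_sequentially by (metis Suc_le_eq order_refl)
  qed
  have "\<exists>q. \<forall>n. True \<and> (q n < q (Suc n) \<and> r (q n) < r (q (Suc n)))"
  proof (rule dependent_nat_choice)
    show "\<exists>y. True \<and> (x < y \<and> r x < r y)" for x n :: nat using ex[of x "r x"] by blast
  qed simp
  then obtain q where "\<And>n. q n < q (Suc n)" "\<And>n. r (q n) < r (q (Suc n))" by blast
  then show ?thesis by (intro exI[of _ q]) (simp add: strict_mono_Suc_iff)
qed

lemma limitin_sequentially_unique:
  "\<lbrakk>Hausdorff_space X; limitin X s x sequentially; limitin X s y sequentially\<rbrakk> \<Longrightarrow> x = y"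
  by (rule limitin_Hausdorff_unique[OF _ _ trivial_limit_sequentially])

lemma Hausdorff_limit_of_constant_subsequence:
  assumes "Hausdorff_space X" "limitin X s x sequentially" "strict_mono (r :: nat \<Rightarrow> nat)"
    "\<And>i. s (r i) = c" "c \<in> topspace X"
  shows "x = c"
proof -
  have "limitin X (\<lambda>i. s (r i)) x sequentially"
    by (rule limitin_reindex[OF filterlim_subseq[OF assms(3)] assms(2)])
  then have "limitin X (\<lambda>i::nat. c) x sequentially" using assms(4) by simp
  moreover have "limitin X (\<lambda>i::nat. c) c sequentially" using assms(5) by simp
  ultimately show ?thesis using limitin_sequentially_unique[OF assms(1)] by blast
qed

text \<open>
  A subsequence that converged anywhere would converge inside the closed set.
\<close>

lemma non_seq_compactin_closed:
  assumes "closedin X K" "\<not> seq_compactin X K"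
  shows "\<exists>a. (\<forall>n. a n \<in> K) \<and> no_convergent_subsequence X a"
proof -
  from assms(2) closedin_subset[OF assms(1)]
  have "\<exists>a. (\<forall>n::nat. a n \<in> K) \<and>
      (\<forall>r. strict_mono r \<longrightarrow> (\<forall>x\<in>K. \<not> limitin X (\<lambda>n. a (r n)) x sequentially))"
    unfolding seq_compactin_def by (simp only: not_all not_imp not_ex de_Morgan_conj) metis
  then obtain a :: "nat \<Rightarrow> 'a" where aK: "\<And>n. a n \<in> K"
    and a: "\<And>r x. \<lbrakk>strict_mono r; x \<in> K\<rbrakk> \<Longrightarrow> \<not> limitin X (\<lambda>n. a (r n)) x sequentially"
    by metis
  have False if r: "filterlim r at_top sequentially" and lim: "limitin X (\<lambda>i. a (r i)) x sequentially" for r x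
  proof -
    obtain q :: "nat \<Rightarrow> nat" where q: "strict_mono q" "strict_mono (r \<circ> q)"
      using filterlim_imp_strict_mono_subsequence[OF r] by auto
    have "limitin X (\<lambda>i. a (r (q i))) x sequentially"
      using limitin_reindex[OF filterlim_subseq[OF q(1)] lim] .
    moreover have "x \<in> K"
      using limitin_closedin[OF lim assms(1)] aK by simp
    ultimately show False using a[OF q(2)] by simp
  qed
  then have "no_convergent_subsequence X a" unfolding no_convergent_subsequence_def by metis
  with aK show ?thesis by auto
qed

lemma seq_compactin_closed:
  assumes "sequential_space X" "Hausdorff_space X" "seq_compactin X K"
  shows "closedin X K"
proof (rule sequential_space_closedI[OF assms(1)])
  show "K \<subseteq> topspace X" using assms(3) by (simp add: seq_compactin_def)
next
  fix s :: "nat \<Rightarrow> 'a" and x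
  assume s: "\<And>n. s n \<in> K" and lim: "limitin X s x sequentially"
  obtain r y where r: "strict_mono r" "y \<in> K" "limitin X (\<lambda>n. s (r n)) y sequentially"
    using assms(3) s unfolding seq_compactin_def by meson
  then have "y = x"
    using limitin_sequentially_unique[OF assms(2) r(3) limitin_reindex[OF filterlim_subseq[OF r(1)] lim]]
    by simp
  then show "x \<in> K" using r(2) by simp
qed

text \<open>
  A countable subcover without finite subcover produces a sequence that leaves its members one after
  another; the limit of a subsequence would lie in one of them.
\<close>

lemma seq_compactin_imp_compactin:
  assumes "sequential_space X" "Hausdorff_space X" "Lindelof_space X" "seq_compactin X K"
  shows "compactin X K"
  unfolding compactin_def
proof (intro conjI allI impI)
  show KX: "K \<subseteq> topspace X" using assms(4) by (simp add: seq_compactin_def)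
  fix \<U> assume U: "Ball \<U> (openin X) \<and> K \<subseteq> \<Union> \<U>"
  have "Lindelof_space (subtopology X K)"
    using Lindelof_space_closedin_subtopology[OF assms(3) seq_compactin_closed] assms by blast
  then obtain \<V> where V: "countable \<V>" "\<V> \<subseteq> \<U>" "K \<subseteq> \<Union>\<V>"
    using U Lindelof_space_subtopology_subset[OF KX] by metis
  show "\<exists>\<F>. finite \<F> \<and> \<F> \<subseteq> \<U> \<and> K \<subseteq> \<Union> \<F>"
  proof (cases "\<V> = {}")
    case True then show ?thesis using V by (intro exI[of _ "{}"]) auto
  next
    case False
    define g where "g = from_nat_into \<V>"
    have g: "range g = \<V>" using False V(1) by (simp add: g_def range_from_nat_into)
    show ?thesis
    proof (rule ccontr)
      assume no: "\<not> ?thesis"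
      have "\<exists>d. d \<in> K \<and> d \<notin> \<Union>(g ` {..n})" for n
      proof (rule ccontr)
        assume "\<not> ?thesis"
        then have "finite (g ` {..n}) \<and> g ` {..n} \<subseteq> \<U> \<and> K \<subseteq> \<Union>(g ` {..n})"
          using g V(2) by auto
        with no show False by blast
      qed
      then obtain d where d: "\<And>n. d n \<in> K" "\<And>n. d n \<notin> \<Union>(g ` {..n})" by metis
      then obtain r x where r: "strict_mono r" "x \<in> K" "limitin X (\<lambda>n. d (r n)) x sequentially"
        using assms(4) unfolding seq_compactin_def by meson
      then obtain m where m: "x \<in> g m" using V(3) g by auto
      have "openin X (g m)" using U V(2) g by blast
      then have "eventually (\<lambda>n. d (r n) \<in> g m) sequentially" using limitinD[OF r(3)] m by blast
      then obtain N where "\<And>n. n \<ge> N \<Longrightarrow> d (r n) \<in> g m" 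
        unfolding eventually_sequentially by blast
      then obtain n where "n \<ge> m" "d (r n) \<in> g m" using max.cobounded1 max.cobounded2 by metis
      moreover have "r n \<ge> n" using r(1) by (rule seq_suble)
      ultimately show False using d(2)[of "r n"] by auto
    qed
  qed
qed

lemma closedin_range_of_divergent:
  assumes "sequential_space X" "Hausdorff_space X" "range a \<subseteq> topspace X" "no_convergent_subsequence X a"
  shows "closedin X (a ` {n..})"
proof (rule sequential_space_closedI[OF assms(1)])
  show "a ` {n..} \<subseteq> topspace X" using assms(3) by auto
next
  fix s :: "nat \<Rightarrow> 'a" and x
  assume s: "\<And>k. s k \<in> a ` {n..}" and lim: "limitin X s x sequentially"
  have "\<forall>k. \<exists>i. n \<le> i \<and> s k = a i" using s by (auto simp: image_iff Bex_def)
  then obtain f where f: "\<And>k. f k \<ge> n" "\<And>k. s k = a (f k)" by metis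
  consider "filterlim f at_top sequentially"
    | m r where "strict_mono (r :: nat \<Rightarrow> nat)" "\<forall>i. f (r i) = m"
    using nat_seq_dichotomy[of f] by metis
  then show "x \<in> a ` {n..}"
  proof cases
    case 1
    have "s = (\<lambda>k. a (f k))" using f(2) by auto
    with no_convergent_subsequenceD[OF assms(4) 1] lim show ?thesis by simp
  next
    case (2 m r)
    then have "x = a m"
      using Hausdorff_limit_of_constant_subsequence[OF assms(2) lim 2(1), of "a m"] f(2) assms(3)
      by (simp add: image_subset_iff)
    then show ?thesis using f(1) 2(2) by (metis atLeast_iff imageI)
  qed
qed

text \<open>
  The points \<open>a j\<close> form a locally finite family, and so do suitable neighbourhoods \<open>G j\<close>: no sequence
  picking points from \<open>G j\<close> for larger and larger \<open>j\<close> converges. The Lindelof property supplies a countable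
  cover by open sets whose closures contain \<open>a j\<close> for only finitely many \<open>j\<close>, and \<open>G j\<close> avoids each of
  these closures with index at most \<open>j\<close> that does not contain \<open>a j\<close>.
\<close>

lemma discrete_expansion:
  assumes "sequential_space X" "Hausdorff_space X" "regular_space X" "Lindelof_space X"
    and aX: "range a \<subseteq> topspace X" and nc: "no_convergent_subsequence X a"
  shows "\<exists>G. (\<forall>j. openin X (G j) \<and> a j \<in> G j) \<and>
    (\<forall>t f z. filterlim f at_top sequentially \<longrightarrow> (\<forall>i::nat. t i \<in> G (f i)) \<longrightarrow> \<not> limitin X t z sequentially)"
proof -
  have "\<exists>V. openin X V \<and> x \<in> V \<and> finite {j. a j \<in> X closure_of V}" if x: "x \<in> topspace X" for x
  proof -
    have "\<exists>n. x \<notin> a ` {n..}"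
    proof (rule ccontr)
      assume "\<not> ?thesis"
      then have *: "\<And>n. \<exists>j\<ge>n. a j = x" by (auto simp: image_iff Bex_def)
      then have "\<exists>\<^sub>F j in sequentially. a j = x" by (auto simp: frequently_sequentially)
      then obtain r :: "nat \<Rightarrow> nat" where r: "strict_mono r" "\<And>n. a (r n) = x"
        using subsequence_frequently[of "\<lambda>n j. a j = x"] by auto
      then have "limitin X (\<lambda>i. a (r i)) x sequentially" using x by simp
      then show False using no_convergent_subsequenceD[OF nc filterlim_subseq[OF r(1)]] by simp
    qed
    then obtain n where n: "x \<notin> a ` {n..}" by blast
    have "openin X (topspace X - a ` {n..})"
      using closedin_range_of_divergent[OF assms(1,2) aX nc] by blast
    then obtain V where V: "openin X V" "x \<in> V" "X closure_of V \<subseteq> topspace X - a ` {n..}"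
      using regular_space_closure_subset[OF assms(3), of "topspace X - a ` {n..}" x] n x by blast
    have "{j. a j \<in> X closure_of V} \<subseteq> {..<n}" using V(3) by (force simp: not_less)
    then show ?thesis using V(1,2) finite_subset by blast
  qed
  then have "\<forall>x\<in>topspace X. \<exists>V. openin X V \<and> x \<in> V \<and> finite {j. a j \<in> X closure_of V}" by simp
  from bchoice[OF this] obtain O' where
    O': "\<forall>x\<in>topspace X. openin X (O' x) \<and> x \<in> O' x \<and> finite {j. a j \<in> X closure_of (O' x)}" ..
  have "\<exists>\<V>. countable \<V> \<and> \<V> \<subseteq> O' ` topspace X \<and> \<Union>\<V> = topspace X"
  proof (rule Lindelof_spaceD[OF assms(4)])
    show "openin X U" if "U \<in> O' ` topspace X" for U using that O' by auto
    have "O' x \<subseteq> topspace X" if "x \<in> topspace X" for x using that O' openin_subset by metis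
    moreover have "x \<in> O' x" if "x \<in> topspace X" for x using that O' by simp
    ultimately show "\<Union>(O' ` topspace X) = topspace X" by auto
  qed
  then obtain \<V> where V: "countable \<V>" "\<V> \<subseteq> O' ` topspace X" "\<Union>\<V> = topspace X" by metis
  have ne: "\<V> \<noteq> {}" using V(3) aX by auto
  define g where "g = from_nat_into \<V>"
  have g: "range g = \<V>" using ne V(1) by (simp add: g_def range_from_nat_into)
  have gO: "openin X (g i)" and gfin: "finite {j. a j \<in> X closure_of (g i)}" for i
  proof -
    have "g i \<in> O' ` topspace X" using g V(2) by auto
    then show "openin X (g i)" "finite {j. a j \<in> X closure_of (g i)}" using O' by auto
  qed
  \<comment> \<open>Finitely many closures are removed, so \<open>G j\<close> is open; a closure containing \<open>a j\<close> must be kept.\<close>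
  define G where "G j = topspace X - \<Union>((\<lambda>i. X closure_of (g i)) ` {i. i \<le> j \<and> a j \<notin> X closure_of (g i)})" for j
  show ?thesis
  proof (intro exI[of _ G] conjI allI impI)
    show "openin X (G j)" for j
      unfolding G_def by (intro openin_diff openin_topspace closedin_Union) auto
    show "a j \<in> G j" for j unfolding G_def using aX by auto
    fix t z and f :: "nat \<Rightarrow> nat" assume f: "filterlim f at_top sequentially" and t: "\<forall>i::nat. t i \<in> G (f i)"
    show "\<not> limitin X t z sequentially"
    proof
      assume lim: "limitin X t z sequentially"
      then have "z \<in> \<Union>(range g)" using g V(3) limitin_topspace[OF lim] by simp
      then obtain p where p: "z \<in> g p" by blast
      obtain N where N: "\<And>j. a j \<in> X closure_of (g p) \<Longrightarrow> j < N"
        using gfin[of p, unfolded finite_nat_set_iff_bounded] by auto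
      have "eventually (\<lambda>i. max N p \<le> f i) sequentially"
        using f by (simp only: filterlim_at_top)
      with limitinD[OF lim gO p] have "eventually (\<lambda>i. t i \<in> g p \<and> max N p \<le> f i) sequentially"
        by (rule eventually_conj)
      from eventually_happens[OF this] obtain i where "t i \<in> g p \<and> max N p \<le> f i" by auto
      then have i: "t i \<in> g p" "f i \<ge> N" "f i \<ge> p" by auto
      have "t i \<in> X closure_of (g p)" using i(1) closure_of_subset[OF openin_subset[OF gO[of p]]] by blast
      moreover have "a (f i) \<notin> X closure_of (g p)" using N[of "f i"] i(2) by linarith
      ultimately show False using t[rule_format, of i] i(3) unfolding G_def by auto
    qed
  qed
qed

section \<open>Closed networks for the sequences converging to a point\<close>

text \<open>
  The members are closed so that one that is not sequentially compact contains a sequence without any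
  convergent subsequence (lemma \<open>non_seq_compactin_closed\<close>). Unlike in a \<open>cs\<^sup>*\<close>-network, finitely many
  terms of the sequences may lie outside the carrier.
\<close>

definition closed_cs_star :: "'a topology \<Rightarrow> 'a \<Rightarrow> 'a set set \<Rightarrow> bool" where
  "closed_cs_star X e \<C> \<longleftrightarrow> countable \<C> \<and> (\<forall>N\<in>\<C>. closedin X N) \<and>
     (\<forall>s U. limitin X s e sequentially \<longrightarrow> openin X U \<longrightarrow> e \<in> U \<longrightarrow>
        (\<exists>N\<in>\<C>. N \<subseteq> U \<and> infinite {n. s n \<in> N}))"

lemma closed_cs_starD:
  "\<lbrakk>closed_cs_star X e \<C>; limitin X s e sequentially; openin X U; e \<in> U\<rbrakk>
    \<Longrightarrow> \<exists>N\<in>\<C>. N \<subseteq> U \<and> infinite {n. s n \<in> N}"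
  unfolding closed_cs_star_def by simp

definition finite_unions :: "'a set set \<Rightarrow> 'a set set" where
  "finite_unions \<C> = Union ` {\<F>. finite \<F> \<and> \<F> \<subseteq> \<C>}"

lemma countable_finite_unions: "countable \<C> \<Longrightarrow> countable (finite_unions \<C>)"
  unfolding finite_unions_def by (intro countable_image countable_Collect_finite_subset)

lemma finite_unions_closedin:
  "\<lbrakk>\<And>N. N \<in> \<C> \<Longrightarrow> closedin X N; M \<in> finite_unions \<C>\<rbrakk> \<Longrightarrow> closedin X M"
  unfolding finite_unions_def by (auto intro!: closedin_Union)

text \<open>
  Regularity puts the closure of a small network element into the given neighbourhood.
\<close>

lemma closed_cs_star_exists:
  assumes "regular_space X" "countable \<N>" "cs_star_network_at X \<N> e"
  shows "closed_cs_star X e ((\<lambda>N. X closure_of N) ` \<N>)"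
  unfolding closed_cs_star_def
proof (intro conjI allI impI)
  show "countable ((\<lambda>N. X closure_of N) ` \<N>)" using assms(2) by simp
  show "\<forall>N\<in>(\<lambda>N. X closure_of N) ` \<N>. closedin X N" by auto
  fix s U assume s: "limitin X s e sequentially" and U: "openin X U" "e \<in> U"
  obtain V where V: "openin X V" "e \<in> V" "X closure_of V \<subseteq> U"
    using regular_space_closure_subset[OF assms(1) U] by metis
  obtain k where k: "\<And>n. n \<ge> k \<Longrightarrow> s n \<in> topspace X"
    using s openin_topspace[of X] unfolding limitin_sequentially by metis
  define s' where "s' = (\<lambda>n. s (n + k))"
  have "limitin X s' e sequentially"
    unfolding s'_def by (rule limitin_sequentially_offset[OF s])
  moreover have "\<forall>n. s' n \<in> topspace X" using k by (simp add: s'_def)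
  moreover note assms(3) V(1,2)
  ultimately obtain N where N: "N \<in> \<N>" "N \<subseteq> V" "infinite {n. s' n \<in> N}"
    unfolding cs_star_network_at_def by meson
  have "N \<subseteq> topspace X" using N(2) openin_subset[OF V(1)] by simp
  then have sub: "N \<subseteq> X closure_of N" by (rule closure_of_subset)
  have "(\<lambda>n. n + k) ` {n. s' n \<in> N} \<subseteq> {n. s n \<in> X closure_of N}" using sub by (auto simp: s'_def)
  moreover have "infinite ((\<lambda>n. n + k) ` {n. s' n \<in> N})" using N(3) by (simp add: finite_image_iff)
  ultimately have "infinite {n. s n \<in> X closure_of N}" by (rule infinite_super)
  moreover have "X closure_of N \<subseteq> U" using closure_of_mono[OF N(2), of X] V(3) by simp
  ultimately show "\<exists>N\<in>(\<lambda>N. X closure_of N) ` \<N>. N \<subseteq> U \<and> infinite {n. s n \<in> N}" using N(1) by auto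
qed

text \<open>
  Unions of the first \<open>n\<close> network elements inside \<open>U\<close> catch almost all terms of each sequence
  converging to \<open>e\<close>: one that escaped infinitely often from each union would have a subsequence meeting every
  element only finitely often.
\<close>

lemma cs_star_exhaustion:
  assumes "closed_cs_star X e \<C>" "openin X U" "e \<in> U"
  shows "\<exists>B :: nat \<Rightarrow> 'a set. incseq B \<and> (\<forall>n. B n \<subseteq> U \<and> B n \<in> finite_unions \<C>) \<and>
     (\<forall>s. limitin X s e sequentially \<longrightarrow> (\<exists>n. eventually (\<lambda>k. s k \<in> B n) sequentially))"
proof -
  have eX: "e \<in> topspace X" using assms(2,3) openin_subset by blast
  define \<V> where "\<V> = {N\<in>\<C>. N \<subseteq> U}"
  have cs: "\<exists>N\<in>\<V>. infinite {n. s n \<in> N}" if "limitin X s e sequentially" for s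
    using closed_cs_starD[OF assms(1) that assms(2,3)] unfolding \<V>_def by auto
  have "\<V> \<noteq> {}" using cs[of "\<lambda>_. e"] eX by auto
  moreover have "countable \<V>" using assms(1) by (simp add: closed_cs_star_def \<V>_def)
  ultimately obtain g :: "nat \<Rightarrow> 'a set" where g: "range g = \<V>" 
    using range_from_nat_into by metis
  define B where "B n = \<Union>(g ` {..n})" for n
  have "incseq B" unfolding B_def by (intro monoI Union_mono image_mono) simp
  moreover have "B n \<subseteq> U" for n using g unfolding B_def \<V>_def by auto
  moreover have "B n \<in> finite_unions \<C>" for n 
  proof -
    have "g ` {..n} \<subseteq> \<C>" using g unfolding \<V>_def by auto
    then show ?thesis unfolding finite_unions_def B_def by (intro imageI) simp
  qed
  moreover have "\<exists>n. eventually (\<lambda>k. s k \<in> B n) sequentially" if s: "limitin X s e sequentially" for s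
  proof (rule ccontr)
    assume "\<not> ?thesis"
    then have "\<exists>\<^sub>F k in sequentially. s k \<notin> B n" for n by (simp add: not_eventually)
    then obtain r :: "nat \<Rightarrow> nat" where r: "strict_mono r" "\<And>n. s (r n) \<notin> B n"
      using subsequence_frequently[of "\<lambda>n k. s k \<notin> B n"] by auto
    obtain N where N: "N \<in> \<V>" "infinite {n. s (r n) \<in> N}"
      using cs[OF limitin_reindex[OF filterlim_subseq[OF r(1)] s]] by auto
    then obtain m where m: "N = g m" using g by auto
    have "\<exists>n\<ge>m. n \<in> {n. s (r n) \<in> N}"
      using N(2)[unfolded infinite_nat_iff_unbounded_le] by (rule spec)
    then obtain n where "n \<ge> m" "s (r n) \<in> N" by auto
    then show False using r(2)[of n] m unfolding B_def by auto
  qed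
  ultimately show ?thesis by (intro exI[of _ B]) auto
qed

lemma cs_network_finite_unions:
  assumes "closed_cs_star X e \<C>" "openin X U" "e \<in> U" "limitin X s e sequentially"
  shows "\<exists>M\<in>finite_unions \<C>. M \<subseteq> U \<and> eventually (\<lambda>k. s k \<in> M) sequentially"
proof -
  obtain B :: "nat \<Rightarrow> 'a set" where B: "\<forall>n. B n \<subseteq> U \<and> B n \<in> finite_unions \<C>"
    "\<forall>s. limitin X s e sequentially \<longrightarrow> (\<exists>n. eventually (\<lambda>k. s k \<in> B n) sequentially)"
    using cs_star_exhaustion[OF assms(1-3)] by auto
  from B(2) assms(4) obtain n where "eventually (\<lambda>k. s k \<in> B n) sequentially" by metis
  then show ?thesis using B(1) by (intro bexI[of _ "B n"]) auto
qed

section \<open>The operations of a rectifiable space\<close>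

locale rectifiable_operations =
  fixes X :: "'a topology" and e :: 'a
    and mul :: "'a \<Rightarrow> 'a \<Rightarrow> 'a" (infixl "\<cdot>" 70)
    and ldiv :: "'a \<Rightarrow> 'a \<Rightarrow> 'a"
  assumes e_in [simp]: "e \<in> topspace X"
    and continuous_mul: "continuous_map (prod_topology X X) X (\<lambda>(x, y). x \<cdot> y)"
    and continuous_ldiv: "continuous_map (prod_topology X X) X (\<lambda>(x, y). ldiv x y)"
    and mul_ldiv [simp]: "\<lbrakk>x \<in> topspace X; y \<in> topspace X\<rbrakk> \<Longrightarrow> x \<cdot> ldiv x y = y"
    and ldiv_mul [simp]: "\<lbrakk>x \<in> topspace X; y \<in> topspace X\<rbrakk> \<Longrightarrow> ldiv x (x \<cdot> y) = y"
    and mul_e [simp]: "x \<in> topspace X \<Longrightarrow> x \<cdot> e = x"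

text \<open>
  Both \<open>H\<close> and its inverse preserve the first coordinate, so their second coordinates are the operations.
\<close>

lemma rectifiable_space_imp_operations:
  assumes "rectifiable_space X"
  shows "\<exists>e mul ldiv. rectifiable_operations X e mul ldiv"
proof -
  let ?P = "prod_topology X X"
  obtain e H where e: "e \<in> topspace X" and H: "homeomorphic_map ?P ?P H"
    and He: "\<And>x. x \<in> topspace X \<Longrightarrow> H (x, e) = (x, x)"
    and Hx: "\<And>x. x \<in> topspace X \<Longrightarrow> H ` ({x} \<times> topspace X) = {x} \<times> topspace X"
    using assms unfolding rectifiable_space_def by auto
  obtain G where HG: "homeomorphic_maps ?P ?P H G" using H homeomorphic_map_maps by metis
  have cont: "continuous_map ?P ?P H" "continuous_map ?P ?P G"
    using HG by (simp_all add: homeomorphic_maps_def)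
  have GH: "G (H p) = p" "H (G p) = p" if "p \<in> topspace X \<times> topspace X" for p
    using HG that unfolding homeomorphic_maps_def topspace_prod_topology by blast+
  have G_in: "G p \<in> topspace X \<times> topspace X" if "p \<in> topspace X \<times> topspace X" for p
    using cont(2) that unfolding continuous_map_def topspace_prod_topology by blast
  have fst_H: "fst (H (x, y)) = x" "snd (H (x, y)) \<in> topspace X" 
    if "x \<in> topspace X" "y \<in> topspace X" for x y
  proof -
    have "H (x, y) \<in> H ` ({x} \<times> topspace X)" using that(2) by simp
    then have "H (x, y) \<in> {x} \<times> topspace X" using Hx[OF that(1)] by simp
    then show "fst (H (x, y)) = x" "snd (H (x, y)) \<in> topspace X" by (simp_all add: mem_Times_iff)
  qed
  have fst_G: "fst (G (x, y)) = x" if "x \<in> topspace X" "y \<in> topspace X" for x y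
  proof -
    have "fst (H (fst (G (x, y)), snd (G (x, y)))) = fst (G (x, y))"
      by (rule fst_H(1)) (use G_in[of "(x, y)"] that in \<open>simp_all add: mem_Times_iff\<close>)
    then show ?thesis using GH(2)[of "(x, y)"] that by simp
  qed
  have "rectifiable_operations X e (\<lambda>x y. snd (H (x, y))) (\<lambda>x y. snd (G (x, y)))"
  proof
    show "e \<in> topspace X" by fact
    show "continuous_map ?P X (\<lambda>(x, y). snd (H (x, y)))"
      using continuous_map_compose[OF cont(1) continuous_map_snd] by (simp add: o_def case_prod_unfold)
    show "continuous_map ?P X (\<lambda>(x, y). snd (G (x, y)))"
      using continuous_map_compose[OF cont(2) continuous_map_snd] by (simp add: o_def case_prod_unfold)
    fix x assume x: "x \<in> topspace X"
    show "snd (H (x, e)) = x" using He[OF x] by simp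
    fix y assume y: "y \<in> topspace X"
    have "G (x, y) = (x, snd (G (x, y)))" using fst_G[OF x y] by (simp add: prod_eq_iff)
    then show "snd (H (x, snd (G (x, y)))) = y" using GH(2)[of "(x, y)"] x y by simp
    have "H (x, y) = (x, snd (H (x, y)))" using fst_H(1)[OF x y] by (simp add: prod_eq_iff)
    then show "snd (G (x, snd (H (x, y)))) = y" using GH(1)[of "(x, y)"] x y by simp
  qed
  then show ?thesis by metis
qed

context rectifiable_operations
begin

lemma mul_in [simp]: "\<lbrakk>x \<in> topspace X; y \<in> topspace X\<rbrakk> \<Longrightarrow> x \<cdot> y \<in> topspace X"
  using continuous_mul by (auto simp: continuous_map_def Pi_iff)

lemma ldiv_in [simp]: "\<lbrakk>x \<in> topspace X; y \<in> topspace X\<rbrakk> \<Longrightarrow> ldiv x y \<in> topspace X"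
  using continuous_ldiv by (auto simp: continuous_map_def Pi_iff)

lemma ldiv_self [simp]: "x \<in> topspace X \<Longrightarrow> ldiv x x = e"
  using ldiv_mul[of x e] by simp

lemma limitin_mul:
  assumes "limitin X s x F" "limitin X t y F"
  shows "limitin X (\<lambda>i. s i \<cdot> t i) (x \<cdot> y) F"
proof -
  have "limitin (prod_topology X X) (\<lambda>i. (s i, t i)) (x, y) F"
    using assms by (simp add: limitin_pairwise o_def)
  from continuous_map_limit[OF continuous_mul this] show ?thesis by (simp add: o_def)
qed

lemma limitin_ldiv:
  assumes "limitin X s x F" "limitin X t y F"
  shows "limitin X (\<lambda>i. ldiv (s i) (t i)) (ldiv x y) F"
proof -
  have "limitin (prod_topology X X) (\<lambda>i. (s i, t i)) (x, y) F"
    using assms by (simp add: limitin_pairwise o_def)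
  from continuous_map_limit[OF continuous_ldiv this] show ?thesis by (simp add: o_def)
qed

lemma mul_open_nbhds:
  assumes "openin X U" "x \<in> topspace X" "y \<in> topspace X" "x \<cdot> y \<in> U"
  shows "\<exists>V W. openin X V \<and> openin X W \<and> x \<in> V \<and> y \<in> W \<and> (\<forall>v\<in>V. \<forall>w\<in>W. v \<cdot> w \<in> U)"
proof -
  have "openin (prod_topology X X) {p \<in> topspace (prod_topology X X). (\<lambda>(x, y). x \<cdot> y) p \<in> U}"
    by (rule openin_continuous_map_preimage[OF continuous_mul assms(1)])
  from this[unfolded openin_prod_topology_alt, rule_format, of x y] assms(2-4)
  show ?thesis by (fastforce simp: subset_iff)
qed

lemma mul_nbhd_e:
  assumes "openin X U" "e \<in> U"
  shows "\<exists>V. openin X V \<and> e \<in> V \<and> (\<forall>v\<in>V. \<forall>w\<in>V. v \<cdot> w \<in> U)"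
proof -
  obtain V W where "openin X V" "openin X W" "e \<in> V" "e \<in> W" "\<forall>v\<in>V. \<forall>w\<in>W. v \<cdot> w \<in> U"
    using mul_open_nbhds[of U e e] assms by auto
  then show ?thesis by (intro exI[of _ "V \<inter> W"]) auto
qed

lemma openin_ldiv_left:
  assumes "openin X U" "y \<in> topspace X"
  shows "openin X {w \<in> topspace X. ldiv w y \<in> U}"
proof -
  have "continuous_map X (prod_topology X X) (\<lambda>w. (w, y))"
    using assms(2) by (simp add: continuous_map_paired)
  from openin_continuous_map_preimage[OF continuous_map_compose[OF this continuous_ldiv] assms(1)]
  show ?thesis by (simp add: o_def)
qed

lemma openin_ldiv_right:
  assumes "openin X U" "x \<in> topspace X"
  shows "openin X {y \<in> topspace X. ldiv x y \<in> U}"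
proof -
  have "continuous_map X (prod_topology X X) (\<lambda>y. (x, y))"
    using assms(2) by (simp add: continuous_map_paired)
  from openin_continuous_map_preimage[OF continuous_map_compose[OF this continuous_ldiv] assms(1)]
  show ?thesis by (simp add: o_def)
qed

text \<open>
  If \<open>v \<cdot> w \<in> U\<close> for \<open>v \<in> V\<close> and \<open>w \<in> W\<close>, then the closure of \<open>V\<close> lies in \<open>U\<close>: near a point \<open>y\<close> of the closure
  there is \<open>v \<in> V\<close> with \<open>ldiv v y \<in> W\<close>, and \<open>y = v \<cdot> ldiv v y\<close>.
\<close>

lemma regular_space: "regular_space X"
  unfolding regular_space
proof (intro allI impI)
  fix C a assume "closedin X C \<and> a \<in> topspace X - C"
  then have C: "closedin X C" and a: "a \<in> topspace X" "a \<notin> C" by auto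
  have "openin X (topspace X - C)" using C by blast
  then obtain V W where VW: "openin X V" "openin X W" "a \<in> V" "e \<in> W"
    and sub: "\<forall>v\<in>V. \<forall>w\<in>W. v \<cdot> w \<in> topspace X - C"
    using mul_open_nbhds[of "topspace X - C" a e] a by auto
  have "y \<notin> C" if y: "y \<in> X closure_of V" for y
  proof -
    have yX: "y \<in> topspace X" using y by (simp add: in_closure_of)
    define D where "D = {w \<in> topspace X. ldiv w y \<in> W}"
    have "openin X D" unfolding D_def by (rule openin_ldiv_left[OF VW(2) yX])
    moreover have "y \<in> D" using yX VW(4) by (simp add: D_def)
    ultimately obtain v where "v \<in> V" "v \<in> D"
      using y unfolding in_closure_of by auto
    then have v: "v \<in> V" "v \<in> topspace X" "ldiv v y \<in> W" by (simp_all add: D_def)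
    then have "v \<cdot> ldiv v y \<in> topspace X - C" using sub by blast
    then show ?thesis using mul_ldiv[OF v(2) yX] by simp
  qed
  then show "\<exists>U. openin X U \<and> a \<in> U \<and> disjnt C (X closure_of U)"
    using VW by (intro exI[of _ V]) (auto simp: disjnt_iff)
qed

end

section \<open>Capturing all sequences by compact sets\<close>

definition network_on :: "'a topology \<Rightarrow> 'a set \<Rightarrow> 'a set set \<Rightarrow> bool" where
  "network_on X S \<D> \<longleftrightarrow> (\<forall>x\<in>S. \<forall>U. openin X U \<longrightarrow> x \<in> U \<longrightarrow> (\<exists>N\<in>\<D>. x \<in> N \<and> N \<subseteq> U))"

lemma network_onD:
  "\<lbrakk>network_on X S \<D>; x \<in> S; openin X U; x \<in> U\<rbrakk> \<Longrightarrow> \<exists>N\<in>\<D>. x \<in> N \<and> N \<subseteq> U"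
  unfolding network_on_def by simp

text \<open>
  Openness in a sequential space is tested by sequences, and each convergent sequence eventually runs,
  together with its limit, inside one of the compact sets.
\<close>

lemma k_omega_space_if_sequences_captured:
  assumes "sequential_space X" "Hausdorff_space X" "countable \<F>" "\<And>F. F \<in> \<F> \<Longrightarrow> compactin X F"
    and cap: "\<And>s x. limitin X s x sequentially \<Longrightarrow> \<exists>F\<in>\<F>. eventually (\<lambda>n. s n \<in> F) sequentially"
  shows "k_omega_space X"
  unfolding k_omega_space_def
proof (intro exI[of _ \<F>] conjI ballI allI impI)
  show "countable \<F>" by fact
  show "compactin X C" if "C \<in> \<F>" for C using assms(4)[OF that] .
  show "\<Union>\<F> = topspace X"
  proof
    show "\<Union>\<F> \<subseteq> topspace X" 
      by (rule Union_least, rule compactin_subset_topspace, rule assms(4))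
    show "topspace X \<subseteq> \<Union>\<F>"
    proof
      fix x assume "x \<in> topspace X"
      then have "limitin X (\<lambda>n::nat. x) x sequentially" by simp
      from cap[OF this] show "x \<in> \<Union>\<F>" by simp
    qed
  qed
  fix U assume UX: "U \<subseteq> topspace X"
  show "openin X U \<longleftrightarrow> (\<forall>C\<in>\<F>. openin (subtopology X C) (C \<inter> U))"
  proof
    assume "openin X U"
    then show "\<forall>C\<in>\<F>. openin (subtopology X C) (C \<inter> U)" by (simp add: openin_subtopology_Int2)
  next
    assume rel: "\<forall>C\<in>\<F>. openin (subtopology X C) (C \<inter> U)"
    show "openin X U"
    proof (rule sequential_space_openI[OF assms(1) UX])
      fix s x assume xU: "x \<in> U" and lim: "limitin X s x sequentially"
      obtain F where F: "F \<in> \<F>" "eventually (\<lambda>n. s n \<in> F) sequentially" using cap[OF lim] by auto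
      have "closedin X F" using compactin_imp_closedin[OF assms(2) assms(4)[OF F(1)]] .
      then have xF: "x \<in> F" using limitin_closedin[OF lim _ F(2)] by simp
      obtain V where V: "openin X V" "F \<inter> U = V \<inter> F"
        using rel F(1) unfolding openin_subtopology by auto
      have "eventually (\<lambda>n. s n \<in> V) sequentially" using limitinD[OF lim V(1)] xU xF V(2) by auto
      from eventually_happens[OF eventually_conj[OF this F(2)]] show "\<exists>n. s n \<in> U" using V(2) by auto
    qed
  qed
qed

lemma seq_compactinD:
  "\<lbrakk>seq_compactin X K; \<forall>n::nat. d n \<in> K\<rbrakk>
    \<Longrightarrow> \<exists>r x. strict_mono r \<and> x \<in> K \<and> limitin X (\<lambda>n. d (r n)) x sequentially"
  unfolding seq_compactin_def by simp

lemma seq_compactin_singleton: "x \<in> topspace X \<Longrightarrow> seq_compactin X {x}"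
  unfolding seq_compactin_def using strict_mono_id by fastforce

locale sequential_rectifiable = rectifiable_operations +
  assumes sequential: "sequential_space X" and Hausdorff: "Hausdorff_space X"
begin

definition prod_set :: "'a set \<Rightarrow> 'a set \<Rightarrow> 'a set" where
  "prod_set A B = (\<lambda>(x, y). x \<cdot> y) ` (A \<times> B)"

lemma prod_setI: "\<lbrakk>a \<in> A; b \<in> B\<rbrakk> \<Longrightarrow> a \<cdot> b \<in> prod_set A B"
  unfolding prod_set_def by force

lemma seq_compactin_prod_set:
  assumes "seq_compactin X K" "seq_compactin X L"
  shows "seq_compactin X (prod_set K L)"
  unfolding seq_compactin_def
proof (intro conjI allI impI)
  have sub: "K \<subseteq> topspace X" "L \<subseteq> topspace X" using assms by (auto simp: seq_compactin_def)
  then show "prod_set K L \<subseteq> topspace X" unfolding prod_set_def by (auto simp: subset_iff)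
  fix d :: "nat \<Rightarrow> 'a" assume d: "\<forall>n. d n \<in> prod_set K L"
  have "\<forall>n. \<exists>p. p \<in> K \<times> L \<and> d n = fst p \<cdot> snd p"
  proof
    fix n
    from d have "d n \<in> prod_set K L" ..
    then obtain p where "p \<in> K \<times> L" "d n = fst p \<cdot> snd p" unfolding prod_set_def by auto
    then show "\<exists>p. p \<in> K \<times> L \<and> d n = fst p \<cdot> snd p" by (intro exI[of _ p] conjI)
  qed
  from choice[OF this] obtain f where f: "\<forall>n. f n \<in> K \<times> L \<and> d n = fst (f n) \<cdot> snd (f n)" ..
  have "\<forall>n. fst (f n) \<in> K" using f by (simp add: mem_Times_iff)
  from seq_compactinD[OF assms(1) this] obtain r :: "nat \<Rightarrow> nat" and x where
    r: "strict_mono r" "x \<in> K" "limitin X (\<lambda>n. fst (f (r n))) x sequentially" by auto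
  have "\<forall>n. snd (f (r n)) \<in> L" using f by (simp add: mem_Times_iff)
  from seq_compactinD[OF assms(2) this] obtain q :: "nat \<Rightarrow> nat" and y where
    q: "strict_mono q" "y \<in> L" "limitin X (\<lambda>n. snd (f (r (q n)))) y sequentially" by auto
  have "limitin X (\<lambda>n. fst (f (r (q n))) \<cdot> snd (f (r (q n)))) (x \<cdot> y) sequentially"
    by (rule limitin_mul[OF limitin_reindex[OF filterlim_subseq[OF q(1)] r(3)] q(3)])
  then have "limitin X (\<lambda>n. d ((r \<circ> q) n)) (x \<cdot> y) sequentially" using f by simp
  moreover have "strict_mono (r \<circ> q)" using r(1) q(1) by (rule strict_mono_o)
  ultimately show "\<exists>r x. strict_mono r \<and> x \<in> prod_set K L \<and> limitin X (\<lambda>n. d (r n)) x sequentially"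
    using prod_setI[OF r(2) q(2)] by (intro exI[of _ "r \<circ> q"] exI[of _ "x \<cdot> y"] conjI)
qed

text \<open>
  Otherwise one picks points \<open>d n \<in> K\<close> such that for \<open>j < n\<close> one of \<open>ldiv (d n) (d j)\<close>, \<open>ldiv (d j) (d n)\<close>
  avoids \<open>B n\<close>. Along a convergent subsequence, both quotients of neighbouring terms converge to
  \<open>e\<close> and are therefore eventually caught by a fixed \<open>B m\<close>. Both quotients are controlled because one says
  that \<open>d\<close> is close to \<open>x\<close> and the other that \<open>x\<close> lies in the translate of \<open>M\<close> by \<open>d\<close>.
\<close>

lemma seq_compactin_totally_bounded:
  assumes K: "seq_compactin X K" and C: "closed_cs_star X e \<C>" and U: "openin X U" "e \<in> U"
  shows "\<exists>M\<in>finite_unions \<C>. M \<subseteq> U \<and>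
    (\<exists>D. finite D \<and> D \<subseteq> K \<and> (\<forall>x\<in>K. \<exists>d\<in>D. ldiv x d \<in> M \<and> ldiv d x \<in> M))"
proof (rule ccontr)
  assume no: "\<not> ?thesis"
  obtain B :: "nat \<Rightarrow> 'a set" where B: "incseq B" "\<And>n. B n \<subseteq> U \<and> B n \<in> finite_unions \<C>"
    and Bcap: "\<And>s. limitin X s e sequentially \<Longrightarrow> \<exists>n. eventually (\<lambda>k. s k \<in> B n) sequentially"
    using cs_star_exhaustion[OF C U] by auto
  have "\<exists>x. x \<in> K \<and> (\<forall>d\<in>D. \<not> (ldiv x d \<in> B n \<and> ldiv d x \<in> B n))" if "finite D \<and> D \<subseteq> K" for n D
  proof (rule ccontr)
    assume "\<not> ?thesis"
    then have "\<forall>x\<in>K. \<exists>d\<in>D. ldiv x d \<in> B n \<and> ldiv d x \<in> B n" by simp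
    then have "\<exists>M\<in>finite_unions \<C>. M \<subseteq> U \<and>
        (\<exists>D. finite D \<and> D \<subseteq> K \<and> (\<forall>x\<in>K. \<exists>d\<in>D. ldiv x d \<in> M \<and> ldiv d x \<in> M))"
      using that B(2)[of n] by (intro bexI[of _ "B n"] conjI exI[of _ D]) simp_all
    with no show False by (rule notE)
  qed
  then have "\<forall>p. \<exists>x. finite (snd p) \<and> snd p \<subseteq> K \<longrightarrow>
      x \<in> K \<and> (\<forall>d\<in>snd p. \<not> (ldiv x d \<in> B (fst p) \<and> ldiv d x \<in> B (fst p)))" by simp
  from choice[OF this] obtain c where c0: "\<forall>p. finite (snd p) \<and> snd p \<subseteq> K \<longrightarrow>
      c p \<in> K \<and> (\<forall>d\<in>snd p. \<not> (ldiv (c p) d \<in> B (fst p) \<and> ldiv d (c p) \<in> B (fst p)))" ..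
  have c: "c (n, D) \<in> K \<and> (\<forall>d\<in>D. \<not> (ldiv (c (n, D)) d \<in> B n \<and> ldiv d (c (n, D)) \<in> B n))"
    if "finite D" "D \<subseteq> K" for n D
    using c0[rule_format, of "(n, D)"] that by simp
  \<comment> \<open>\<open>S n\<close> is the set of the points chosen before step \<open>n\<close>.\<close>
  define S where "S = rec_nat {} (\<lambda>n D. insert (c (n, D)) D)"
  have S_Suc: "S (Suc n) = insert (c (n, S n)) (S n)" and S_0: "S 0 = {}" for n by (simp_all add: S_def)
  have S: "finite (S n) \<and> S n \<subseteq> K" for n
    by (induction n) (use c in \<open>simp_all add: S_0 S_Suc\<close>)
  define d where "d n = c (n, S n)" for n
  have dS: "d j \<in> S n" if "j < n" for j n
    using that by (induction n) (auto simp: S_Suc d_def less_Suc_eq)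
  have d: "d n \<in> K" and dn: "\<And>x. x \<in> S n \<Longrightarrow> \<not> (ldiv (d n) x \<in> B n \<and> ldiv x (d n) \<in> B n)" for n
    using c[of "S n" n] S[of n] by (simp_all add: d_def)
  from d have "\<forall>n. d n \<in> K" by simp
  from seq_compactinD[OF K this] obtain r :: "nat \<Rightarrow> nat" and x where
    r: "strict_mono r" "x \<in> K" "limitin X (\<lambda>n. d (r n)) x sequentially" by auto
  have x: "x \<in> topspace X" using r(3) limitin_topspace by metis
  have suc: "limitin X (\<lambda>n. d (r (Suc n))) x sequentially"
    using limitin_sequentially_offset[OF r(3), of 1] by simp
  obtain m where m: "eventually (\<lambda>k. ldiv (d (r (Suc k))) (d (r k)) \<in> B m) sequentially"
    using Bcap[of "\<lambda>k. ldiv (d (r (Suc k))) (d (r k))"] limitin_ldiv[OF suc r(3)] x by auto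
  obtain m' where m': "eventually (\<lambda>k. ldiv (d (r k)) (d (r (Suc k))) \<in> B m') sequentially"
    using Bcap[of "\<lambda>k. ldiv (d (r k)) (d (r (Suc k)))"] limitin_ldiv[OF r(3) suc] x by auto
  have "eventually (\<lambda>k. max m m' \<le> k \<and> ldiv (d (r (Suc k))) (d (r k)) \<in> B m
      \<and> ldiv (d (r k)) (d (r (Suc k))) \<in> B m') sequentially"
    by (intro eventually_conj m m' eventually_ge_at_top)
  from eventually_happens[OF this] obtain k where k: "m \<le> k" "m' \<le> k"
    "ldiv (d (r (Suc k))) (d (r k)) \<in> B m" "ldiv (d (r k)) (d (r (Suc k))) \<in> B m'" by auto
  have "k \<le> r (Suc k)" using seq_suble[OF r(1), of "Suc k"] by simp
  then have "B m \<subseteq> B (r (Suc k))" "B m' \<subseteq> B (r (Suc k))" using k B(1) by (simp_all add: incseqD)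
  moreover have "d (r k) \<in> S (r (Suc k))" using dS strict_monoD[OF r(1), of k "Suc k"] by simp
  ultimately show False using dn[of "d (r k)" "r (Suc k)"] k(3,4) by auto
qed

text \<open>
  The translates \<open>d \<cdot> M\<close> by the points of the finite nets work: \<open>d \<in> x \<cdot> M\<close> is close to \<open>x\<close>, hence all of
  \<open>d \<cdot> M\<close> is close to \<open>x\<close>, and it contains \<open>x\<close>.
\<close>

lemma seq_compactin_network:
  assumes K: "seq_compactin X K" and C: "closed_cs_star X e \<C>"
  shows "\<exists>\<D>. countable \<D> \<and> network_on X K \<D>"
proof -
  have KX: "K \<subseteq> topspace X" using K by (simp add: seq_compactin_def)
  define Q where "Q M D \<longleftrightarrow> finite D \<and> D \<subseteq> K \<and> (\<forall>x\<in>K. \<exists>d\<in>D. ldiv x d \<in> M \<and> ldiv d x \<in> M)" for M D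
  define \<M> where "\<M> = {M \<in> finite_unions \<C>. \<exists>D. Q M D}"
  have cM: "countable \<M>" 
    using C countable_finite_unions[of \<C>] by (simp add: \<M>_def closed_cs_star_def)
  have "\<forall>M\<in>\<M>. \<exists>D. Q M D" by (simp add: \<M>_def)
  from bchoice[OF this] obtain D where D: "\<forall>M\<in>\<M>. Q M (D M)" ..
  define \<D> where "\<D> = (\<lambda>(M, d). (\<lambda>m. d \<cdot> m) ` M) ` (SIGMA M:\<M>. D M)"
  have "countable (SIGMA M:\<M>. D M)"
    using cM D by (intro countable_SIGMA) (auto simp: Q_def intro: countable_finite)
  then have "countable \<D>" unfolding \<D>_def by simp
  moreover have "network_on X K \<D>"
    unfolding network_on_def
  proof (intro ballI allI impI)
    fix x U assume x: "x \<in> K" and U: "openin X U" "x \<in> U"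
    have xX: "x \<in> topspace X" using x KX by auto
    obtain V W where VW: "openin X V" "openin X W" "x \<in> V" "e \<in> W" "\<forall>v\<in>V. \<forall>w\<in>W. v \<cdot> w \<in> U"
      using mul_open_nbhds[of U x e] U xX by auto
    obtain V' W' where VW': "openin X V'" "openin X W'" "x \<in> V'" "e \<in> W'" "\<forall>v\<in>V'. \<forall>w\<in>W'. v \<cdot> w \<in> V"
      using mul_open_nbhds[of V x e] VW xX by auto
    have "openin X (W \<inter> W')" "e \<in> W \<inter> W'" using VW VW' by auto
    from seq_compactin_totally_bounded[OF K C this] obtain M where
      M: "M \<in> finite_unions \<C>" "M \<subseteq> W \<inter> W'" "\<exists>D. Q M D" unfolding Q_def by auto
    then have MM: "M \<in> \<M>" by (simp add: \<M>_def)
    then have QM: "Q M (D M)" using D by simp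
    then obtain d where d: "d \<in> D M" "ldiv x d \<in> M" "ldiv d x \<in> M" using x unfolding Q_def by auto
    have dK: "d \<in> K" using QM d(1) unfolding Q_def by auto
    have dX: "d \<in> topspace X" using dK KX by auto
    have "x \<cdot> ldiv x d \<in> V" using VW'(3,5) M(2) d(2) by auto
    then have dV: "d \<in> V" using xX dX by simp
    have "x \<in> (\<lambda>m. d \<cdot> m) ` M" using d(3) xX dX by (intro image_eqI[of _ _ "ldiv d x"]) simp_all
    moreover have "(\<lambda>m. d \<cdot> m) ` M \<subseteq> U" using VW(5) dV M(2) by auto
    moreover have "(\<lambda>m. d \<cdot> m) ` M \<in> \<D>" unfolding \<D>_def using MM d(1) by (intro image_eqI[of _ _ "(M, d)"]) auto
    ultimately show "\<exists>N\<in>\<D>. x \<in> N \<and> N \<subseteq> U" by auto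
  qed
  ultimately show ?thesis by auto
qed

text \<open>
  Starting with \<open>{e}\<close> and multiplying by members of \<open>\<K>\<close> on the right gives countably many sets that capture
  all sequences converging to points of their union \<open>Q\<close>: if \<open>s n \<longrightarrow> x\<close> then \<open>ldiv x (s n) \<longrightarrow> e\<close>. Hence
  \<open>Q\<close> is open, and countably many of its translates cover a Lindelof space.
\<close>

lemma capturing_family:
  assumes Lin: "Lindelof_space X" and cK: "countable \<K>" and K: "\<And>K. K \<in> \<K> \<Longrightarrow> seq_compactin X K"
    and cap: "\<And>s. limitin X s e sequentially \<Longrightarrow> \<exists>K\<in>\<K>. eventually (\<lambda>n. s n \<in> K) sequentially"
  shows "\<exists>\<F>. countable \<F> \<and> (\<forall>F\<in>\<F>. seq_compactin X F) \<and>
    (\<forall>s x. limitin X s x sequentially \<longrightarrow> (\<exists>F\<in>\<F>. eventually (\<lambda>n. s n \<in> F) sequentially))"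
proof -
  define \<P> where "\<P> = rec_nat {{e}} (\<lambda>n \<P>. (\<lambda>(P, K). prod_set P K) ` (\<P> \<times> \<K>))"
  have P0: "\<P> 0 = {{e}}" and PS: "\<P> (Suc n) = (\<lambda>(P, K). prod_set P K) ` (\<P> n \<times> \<K>)" for n
    by (simp_all add: \<P>_def)
  have cP: "countable (\<P> n)" for n by (induction n) (simp_all add: P0 PS cK)
  have scP: "\<forall>P\<in>\<P> n. seq_compactin X P" for n
    by (induction n) (simp_all add: P0 PS seq_compactin_singleton seq_compactin_prod_set K)
  define \<R> where "\<R> = (\<Union>n. \<P> n)"
  have cR: "countable \<R>" unfolding \<R>_def using cP by simp
  have scR: "seq_compactin X P" if "P \<in> \<R>" for P using that scP unfolding \<R>_def by auto
  have prodR: "prod_set P K \<in> \<R>" if PK: "P \<in> \<R>" "K \<in> \<K>" for P K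
  proof -
    obtain n where "P \<in> \<P> n" using PK(1) unfolding \<R>_def by auto
    then have "prod_set P K \<in> \<P> (Suc n)" unfolding PS using PK(2) by (intro image_eqI[of _ _ "(P, K)"]) auto
    then show ?thesis unfolding \<R>_def by (rule UN_I[OF UNIV_I])
  qed
  have capR: "\<exists>P'\<in>\<R>. eventually (\<lambda>n. s n \<in> P') sequentially"
    if P: "P \<in> \<R>" "x \<in> P" and lim: "limitin X s x sequentially" for P x s
  proof -
    have x: "x \<in> topspace X" using lim by (rule limitin_topspace)
    have cx: "limitin X (\<lambda>n::nat. x) x sequentially" using x by simp
    have "limitin X (\<lambda>n. ldiv x (s n)) e sequentially" using limitin_ldiv[OF cx lim] x by simp
    from cap[OF this] obtain K where K: "K \<in> \<K>" "eventually (\<lambda>n. ldiv x (s n) \<in> K) sequentially" by auto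
    have "eventually (\<lambda>n. s n \<in> topspace X) sequentially" using limitinD[OF lim openin_topspace x] .
    with K(2) have "eventually (\<lambda>n. s n \<in> prod_set P K) sequentially"
    proof eventually_elim
      case (elim n)
      then show ?case using prod_setI[OF P(2) elim(1)] x by simp
    qed
    then show ?thesis using prodR[OF P(1) K(1)] by auto
  qed
  define Q where "Q = \<Union>\<R>"
  have eQ: "{e} \<in> \<R>" unfolding \<R>_def using P0 by (intro UN_I[of 0]) simp_all
  have "openin X Q"
  proof (rule sequential_space_openI[OF sequential])
    show "Q \<subseteq> topspace X" using scR unfolding Q_def seq_compactin_def by auto
    fix s x assume "x \<in> Q" and lim: "limitin X s x sequentially"
    then obtain P where "P \<in> \<R>" "x \<in> P" unfolding Q_def by auto
    from capR[OF this lim] obtain P' where P': "P' \<in> \<R>" "eventually (\<lambda>n. s n \<in> P') sequentially" by auto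
    from eventually_happens[OF P'(2)] obtain n where "s n \<in> P'" by auto
    then show "\<exists>n. s n \<in> Q" using P'(1) unfolding Q_def by auto
  qed
  define G where "G t = {y \<in> topspace X. ldiv t y \<in> Q}" for t
  have "\<exists>\<V>. countable \<V> \<and> \<V> \<subseteq> G ` topspace X \<and> \<Union>\<V> = topspace X"
  proof (rule Lindelof_spaceD[OF Lin])
    show "openin X U" if "U \<in> G ` topspace X" for U
      using that openin_ldiv_right[OF \<open>openin X Q\<close>] by (auto simp: G_def)
    show "\<Union>(G ` topspace X) = topspace X"
    proof
      show "\<Union>(G ` topspace X) \<subseteq> topspace X" by (auto simp: G_def)
      show "topspace X \<subseteq> \<Union>(G ` topspace X)"
      proof
        fix x assume x: "x \<in> topspace X"
        then have "x \<in> G x" using eQ by (auto simp: G_def Q_def)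
        then show "x \<in> \<Union>(G ` topspace X)" using x by auto
      qed
    qed
  qed
  then obtain \<V> where V: "countable \<V>" "\<V> \<subseteq> G ` topspace X" "\<Union>\<V> = topspace X" by metis
  obtain T where T: "countable T" "T \<subseteq> topspace X" "\<V> = G ` T"
    using V(1,2) countable_subset_image[of \<V> G "topspace X"] by auto
  define \<F> where "\<F> = (\<lambda>(t, P). prod_set {t} P) ` (T \<times> \<R>)"
  show ?thesis
  proof (intro exI[of _ \<F>] conjI ballI allI impI)
    show "countable \<F>" unfolding \<F>_def using T(1) cR by simp
    show "seq_compactin X F" if "F \<in> \<F>" for F
      using that T(2) scR unfolding \<F>_def by (auto intro!: seq_compactin_prod_set seq_compactin_singleton)
    fix s x assume lim: "limitin X s x sequentially"
    have x: "x \<in> topspace X" using lim by (rule limitin_topspace)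
    then have "x \<in> \<Union>(G ` T)" using T(3) V(3) by simp
    then obtain t where t: "t \<in> T" "ldiv t x \<in> Q" unfolding G_def by auto
    have tX: "t \<in> topspace X" using t(1) T(2) by auto
    obtain P where P: "P \<in> \<R>" "ldiv t x \<in> P" using t(2) unfolding Q_def by auto
    have "limitin X (\<lambda>n::nat. t) t sequentially" using tX by simp
    from capR[OF P limitin_ldiv[OF this lim]] obtain P' where
      P': "P' \<in> \<R>" "eventually (\<lambda>n. ldiv t (s n) \<in> P') sequentially" by auto
    have "eventually (\<lambda>n. s n \<in> topspace X) sequentially" using limitinD[OF lim openin_topspace x] .
    with P'(2) have "eventually (\<lambda>n. s n \<in> prod_set {t} P') sequentially"
    proof eventually_elim
      case (elim n)
      then show ?case using prod_setI[OF singletonI elim(1), of t] tX by simp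
    qed
    moreover have "prod_set {t} P' \<in> \<F>" unfolding \<F>_def using t(1) P'(1) by (intro image_eqI[of _ _ "(t, P')"]) auto
    ultimately show "\<exists>F\<in>\<F>. eventually (\<lambda>n. s n \<in> F) sequentially" by auto
  qed
qed

lemma k_omega_and_network:
  assumes Lin: "Lindelof_space X" and C: "closed_cs_star X e \<C>"
    and cK: "countable \<K>" and K: "\<And>K. K \<in> \<K> \<Longrightarrow> seq_compactin X K"
    and cap: "\<And>s. limitin X s e sequentially \<Longrightarrow> \<exists>K\<in>\<K>. eventually (\<lambda>n. s n \<in> K) sequentially"
  shows "k_omega_space X \<and> (\<exists>\<D>. countable \<D> \<and> network_on X (topspace X) \<D>)"
proof -
  have "\<exists>\<F>. countable \<F> \<and> (\<forall>F\<in>\<F>. seq_compactin X F) \<and>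
    (\<forall>s x. limitin X s x sequentially \<longrightarrow> (\<exists>F\<in>\<F>. eventually (\<lambda>n. s n \<in> F) sequentially))"
    by (rule capturing_family[OF Lin cK K cap])
  then obtain \<F> where F: "countable \<F>" "\<forall>F\<in>\<F>. seq_compactin X F"
    and capF0: "\<forall>s x. limitin X s x sequentially \<longrightarrow> (\<exists>F\<in>\<F>. eventually (\<lambda>n. s n \<in> F) sequentially)"
    by (elim exE conjE)
  have capF: "\<exists>F\<in>\<F>. eventually (\<lambda>n. s n \<in> F) sequentially" if "limitin X s x sequentially" for s x
    by (rule capF0[rule_format, OF that])
  have "k_omega_space X"
    by (rule k_omega_space_if_sequences_captured[OF sequential Hausdorff F(1) _ capF])
       (use F(2) seq_compactin_imp_compactin[OF sequential Hausdorff Lin] in auto)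
  moreover have "\<exists>\<D>. countable \<D> \<and> network_on X (topspace X) \<D>"
  proof -
    have "\<forall>F\<in>\<F>. \<exists>\<D>. countable \<D> \<and> network_on X F \<D>"
      using F(2) seq_compactin_network[OF _ C] by simp
    from bchoice[OF this] obtain D where D: "\<forall>F\<in>\<F>. countable (D F) \<and> network_on X F (D F)" ..
    have "countable (\<Union>F\<in>\<F>. D F)" using F(1) D by simp
    moreover have "network_on X (topspace X) (\<Union>F\<in>\<F>. D F)"
      unfolding network_on_def
    proof (intro ballI allI impI)
      fix x U assume x: "x \<in> topspace X" and U: "openin X U" "x \<in> U"
      have "limitin X (\<lambda>n::nat. x) x sequentially" using x by simp
      from capF[OF this] obtain F where F': "F \<in> \<F>" "x \<in> F" by auto
      then have "network_on X F (D F)" using D by simp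
      from network_onD[OF this F'(2) U] obtain N where "N \<in> D F" "x \<in> N" "N \<subseteq> U" by auto
      then show "\<exists>N\<in>\<Union>F\<in>\<F>. D F. x \<in> N \<and> N \<subseteq> U" using F'(1) by auto
    qed
    ultimately show ?thesis by auto
  qed
  ultimately show ?thesis by simp
qed

end

section \<open>Metric fans and first countability\<close>

text \<open>
  The rows \<open>a k\<close> are the spines of the metric fan: each is closed and discrete, and they shrink to \<open>e\<close>.
\<close>

definition metric_fan :: "'a topology \<Rightarrow> 'a \<Rightarrow> (nat \<Rightarrow> nat \<Rightarrow> 'a) \<Rightarrow> bool" where
  "metric_fan X e a \<longleftrightarrow> (\<forall>k j. a k j \<in> topspace X) \<and>
     (\<forall>U. openin X U \<longrightarrow> e \<in> U \<longrightarrow> eventually (\<lambda>k. \<forall>j. a k j \<in> U) sequentially) \<and>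
     (\<forall>k. no_convergent_subsequence X (a k))"

text \<open>
  The failure of this property is a Frechet-Urysohn fan at \<open>e\<close> whose crossing sequences all diverge. The
  limit \<open>z\<close> may differ from \<open>e\<close>.
\<close>

definition crossing_property :: "'a topology \<Rightarrow> 'a \<Rightarrow> bool" where
  "crossing_property X e \<longleftrightarrow> (\<forall>s. (\<forall>n::nat. limitin X (s n) e sequentially) \<longrightarrow>
     (\<exists>g h z. filterlim g at_top sequentially \<and>
        limitin X (\<lambda>i::nat. s (g i) (h i :: nat)) z sequentially))"

lemma crossing_propertyD:
  assumes "crossing_property X e" "\<forall>n::nat. limitin X (s n) e sequentially"
  shows "\<exists>g h z. filterlim g at_top sequentially \<and>
    limitin X (\<lambda>i::nat. s (g i) (h i :: nat)) z sequentially"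
  using assms unfolding crossing_property_def by (elim allE[where x=s]) simp

text \<open>
  For a sequence that is eventually in no sequentially compact member, the finite intersections of the
  network elements containing almost all of its terms shrink to \<open>e\<close> and are not sequentially compact.
\<close>

lemma capturing_or_metric_fan:
  assumes C: "closed_cs_star X e \<C>" and e: "e \<in> topspace X"
  shows "(\<exists>\<K>. countable \<K> \<and> (\<forall>K\<in>\<K>. seq_compactin X K) \<and>
      (\<forall>s. limitin X s e sequentially \<longrightarrow> (\<exists>K\<in>\<K>. eventually (\<lambda>n. s n \<in> K) sequentially))) \<or>
    (\<exists>a. metric_fan X e a)"
proof -
  define \<U> where "\<U> = finite_unions \<C>"
  define \<I> where "\<I> = Inter ` {\<F>. finite \<F> \<and> \<F> \<subseteq> \<U>}"
  have c: "countable \<U>" using C countable_finite_unions[of \<C>] by (simp add: \<U>_def closed_cs_star_def)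
  then have cI: "countable \<I>" unfolding \<I>_def by (intro countable_image countable_Collect_finite_subset)
  have clU: "closedin X M" if "M \<in> \<U>" for M
    using that C finite_unions_closedin[of \<C> X M] by (simp add: \<U>_def closed_cs_star_def)
  define \<K> where "\<K> = {K\<in>\<I>. seq_compactin X K}"
  show ?thesis
  proof (cases "\<forall>s. limitin X s e sequentially \<longrightarrow> (\<exists>K\<in>\<K>. eventually (\<lambda>n. s n \<in> K) sequentially)")
    case True
    have "countable \<K>" "\<forall>K\<in>\<K>. seq_compactin X K" using cI by (simp_all add: \<K>_def)
    with True show ?thesis by (intro disjI1 exI[of _ \<K>]) simp
  next
    case False
    then obtain s where s: "limitin X s e sequentially"
      and no: "\<And>K. K \<in> \<K> \<Longrightarrow> \<not> eventually (\<lambda>n. s n \<in> K) sequentially" by auto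
    define \<M> where "\<M> = {M\<in>\<U>. eventually (\<lambda>n. s n \<in> M) sequentially}"
    have net: "\<exists>M\<in>\<M>. M \<subseteq> U" if "openin X U" "e \<in> U" for U
      using cs_network_finite_unions[OF C that s] by (auto simp: \<M>_def \<U>_def)
    then have "\<M> \<noteq> {}" using e by blast
    moreover have "countable \<M>" using c by (simp add: \<M>_def)
    ultimately obtain g :: "nat \<Rightarrow> 'a set" where g: "range g = \<M>" using range_from_nat_into by metis
    have gU: "g i \<in> \<U>" and gs: "eventually (\<lambda>n. s n \<in> g i) sequentially" for i
      using g unfolding \<M>_def by auto
    define P where "P k = \<Inter>(g ` {..k})" for k
    have Pcl: "closedin X (P k)" for k unfolding P_def using gU clU by (intro closedin_Inter) auto
    have "P k \<in> \<I>" for k unfolding \<I>_def P_def using gU by (intro imageI) auto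
    moreover have "eventually (\<lambda>n. \<forall>i\<in>{..k}. s n \<in> g i) sequentially" for k
      using gs by (simp add: eventually_ball_finite)
    then have "eventually (\<lambda>n. s n \<in> P k) sequentially" for k unfolding P_def by simp
    ultimately have nsc: "\<not> seq_compactin X (P k)" for k using no[of "P k"] unfolding \<K>_def by blast
    have "\<forall>k. \<exists>a. (\<forall>n. a n \<in> P k) \<and> no_convergent_subsequence X a"
      using non_seq_compactin_closed[OF Pcl nsc] by simp
    from choice[OF this] obtain a where a: "\<forall>k. (\<forall>n. a k n \<in> P k) \<and> no_convergent_subsequence X (a k)" ..
    have "metric_fan X e a"
      unfolding metric_fan_def
    proof (intro conjI allI impI)
      show "a k j \<in> topspace X" for k j using a closedin_subset[OF Pcl[of k]] by auto
      show "no_convergent_subsequence X (a k)" for k using a by simp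
      fix U assume "openin X U" "e \<in> U"
      from net[OF this] obtain i where i: "g i \<subseteq> U" using g by auto
      have "P k \<subseteq> g i" if "i \<le> k" for k unfolding P_def using that by auto
      then have "\<forall>j. a k j \<in> U" if "i \<le> k" for k using that i a by blast
      then show "eventually (\<lambda>k. \<forall>j. a k j \<in> U) sequentially" 
        unfolding eventually_sequentially by (intro exI[of _ i]) simp
    qed
    then show ?thesis by (intro disjI2 exI[of _ a])
  qed
qed

context sequential_rectifiable
begin

text \<open>
  Suppose that no crossing sequence converges. For each \<open>n\<close> and \<open>j\<close> choose \<open>m\<close> so large that \<open>p n j = a n j \<cdot> s n m\<close> stays
  in the \<open>j\<close>-th set of a discrete expansion of row \<open>n\<close>. Then \<open>e\<close> is in the closure of the set of these
  products. A sequence of products converging outside the set cannot stay in one row because of the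
  expansion. If it moves to higher rows, then its \<open>a\<close>-factor tends to \<open>e\<close>, and left division recovers
  a convergent crossing sequence of \<open>s\<close>-factors. Division is possible only on the left, so the factor
  \<open>a\<close> that tends to \<open>e\<close> comes first, and a fixed row needs the expansion, that is, the Lindelof property.
\<close>

lemma metric_fan_imp_crossing_property:
  assumes Lin: "Lindelof_space X" and fan: "metric_fan X e a"
  shows "crossing_property X e"
  unfolding crossing_property_def
proof (intro allI impI)
  fix s :: "nat \<Rightarrow> nat \<Rightarrow> 'a"
  assume s: "\<forall>n. limitin X (s n) e sequentially"
  have aX: "a n j \<in> topspace X" for n j using fan by (simp add: metric_fan_def)
  have nca: "no_convergent_subsequence X (a n)" for n using fan by (simp add: metric_fan_def)
  show "\<exists>g h z. filterlim g at_top sequentially \<and> limitin X (\<lambda>i. s (g i) (h i)) z sequentially"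
  proof (rule ccontr)
    assume "\<not> ?thesis"
    then have nocross: "\<not> limitin X (\<lambda>i. s (g i) (h i)) z sequentially"
      if "filterlim g at_top sequentially" for g h z using that by blast
    have "\<exists>G. (\<forall>j. openin X (G j) \<and> a n j \<in> G j) \<and>
        (\<forall>t f z. filterlim f at_top sequentially \<longrightarrow> (\<forall>i::nat. t i \<in> G (f i)) \<longrightarrow> \<not> limitin X t z sequentially)" for n
      by (rule discrete_expansion[OF sequential Hausdorff regular_space Lin _ nca]) (use aX in auto)
    from choice[OF allI, OF this] obtain G where G: "\<forall>n. (\<forall>j. openin X (G n j) \<and> a n j \<in> G n j) \<and>
        (\<forall>t f z. filterlim f at_top sequentially \<longrightarrow> (\<forall>i::nat. t i \<in> G n (f i)) \<longrightarrow> \<not> limitin X t z sequentially)" ..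
    have Gop: "openin X (G n j)" "a n j \<in> G n j" for n j using G by auto
    have Gno: "\<not> limitin X t z sequentially"
      if "filterlim f at_top sequentially" "\<forall>i::nat. t i \<in> G n (f i)" for n f t z
      by (rule G[THEN spec, of n, THEN conjunct2, rule_format, OF that(1)]) (use that(2) in simp)
    have "\<forall>q. \<exists>m. snd q \<le> m \<and> a (fst q) (snd q) \<cdot> s (fst q) m \<in> G (fst q) (snd q) \<and> s (fst q) m \<in> topspace X"
    proof
      fix q :: "nat \<times> nat"
      let ?n = "fst q" and ?j = "snd q"
      have "limitin X (\<lambda>m::nat. a ?n ?j) (a ?n ?j) sequentially" using aX by simp
      from limitin_mul[OF this s[rule_format, of ?n]]
      have "limitin X (\<lambda>m. a ?n ?j \<cdot> s ?n m) (a ?n ?j) sequentially" using aX by simp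
      from limitinD[OF this Gop]
      have "eventually (\<lambda>m. a ?n ?j \<cdot> s ?n m \<in> G ?n ?j) sequentially" .
      moreover have "eventually (\<lambda>m. s ?n m \<in> topspace X) sequentially"
        using limitinD[OF s[rule_format, of ?n] openin_topspace] by simp
      ultimately have "eventually (\<lambda>m. ?j \<le> m \<and> a ?n ?j \<cdot> s ?n m \<in> G ?n ?j \<and> s ?n m \<in> topspace X) sequentially"
        by (intro eventually_conj eventually_ge_at_top)
      from eventually_happens[OF this]
      show "\<exists>m. ?j \<le> m \<and> a ?n ?j \<cdot> s ?n m \<in> G ?n ?j \<and> s ?n m \<in> topspace X" by simp
    qed
    from choice[OF this] obtain m where m: "\<forall>q. snd q \<le> m q \<and> a (fst q) (snd q) \<cdot> s (fst q) (m q) \<in> G (fst q) (snd q)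
      \<and> s (fst q) (m q) \<in> topspace X" ..
    have mj: "j \<le> m (n, j)" and mG: "a n j \<cdot> s n (m (n, j)) \<in> G n j" and mX: "s n (m (n, j)) \<in> topspace X" for n j
      using m[rule_format, of "(n, j)"] by simp_all
    define p where "p n j = a n j \<cdot> s n (m (n, j))" for n j
    have pX: "p n j \<in> topspace X" for n j unfolding p_def using aX mX by simp
    have pG: "p n j \<in> G n j" for n j unfolding p_def by (rule mG)
    \<comment> \<open>A product may equal \<open>e\<close>, but by the expansion no row equals \<open>e\<close> from some index on.\<close>
    define A where "A = {p n j | n j. True} - {e}"
    have AX: "A \<subseteq> topspace X" using pX by (auto simp: A_def)
    have "\<not> closedin X A"
    proof
      assume cl: "closedin X A"
      have "openin X (topspace X - A)" using cl by (simp add: closedin_def)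
      moreover have "e \<in> topspace X - A" by (simp add: A_def)
      ultimately obtain V where V: "openin X V" "e \<in> V" "\<forall>v\<in>V. \<forall>w\<in>V. v \<cdot> w \<in> topspace X - A"
        using mul_nbhd_e[of "topspace X - A"] by auto
      have "eventually (\<lambda>k. \<forall>j. a k j \<in> V) sequentially" using fan V(1,2) by (simp add: metric_fan_def)
      from eventually_happens[OF this] obtain k where k: "\<forall>j. a k j \<in> V" by auto
      obtain N where N: "\<forall>n\<ge>N. s k n \<in> V"
        using limitinD[OF s[rule_format, of k] V(1,2)] by (auto simp: eventually_sequentially)
      have pe: "p k j = e" if "j \<ge> N" for j
      proof -
        have "s k (m (k, j)) \<in> V" using N mj[of j k] that by simp
        then have "p k j \<notin> A" using V(3) k unfolding p_def by simp
        then show ?thesis unfolding A_def by blast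
      qed
      have "limitin X (\<lambda>i. p k (i + N)) e sequentially" using pe by simp
      moreover have "filterlim (\<lambda>i. i + N) at_top sequentially"
        by (rule filterlim_subseq) (simp add: strict_mono_def)
      ultimately show False using Gno[of "\<lambda>i. i + N" "\<lambda>i. p k (i + N)" k e] pG by simp
    qed
    then obtain t x where t: "\<forall>i::nat. t i \<in> A" and xA: "x \<in> topspace X - A" and lim: "limitin X t x sequentially"
      using sequential AX unfolding sequential_space_def by metis
    have "\<forall>i. \<exists>q. t i = p (fst q) (snd q)"
    proof
      fix i
      have "t i \<in> A" using t by simp
      then obtain n j where "t i = p n j" unfolding A_def by auto
      then show "\<exists>q. t i = p (fst q) (snd q)" by (intro exI[of _ "(n, j)"]) simp
    qed
    from choice[OF this] obtain q where q: "\<forall>i. t i = p (fst (q i)) (snd (q i))" ..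
    define f where "f i = fst (q i)" for i
    define h where "h i = snd (q i)" for i
    have tp: "t i = p (f i) (h i)" for i using q by (simp add: f_def h_def)
    \<comment> \<open>The sequence moves to higher rows or has a subsequence in one row.\<close>
    from nat_seq_dichotomy[of f] show False
    proof (elim disjE exE conjE)
      assume f: "filterlim f at_top sequentially"
      have "limitin X (\<lambda>i. a (f i) (h i)) e sequentially"
        unfolding limitin_def
      proof (intro conjI allI impI)
        fix U assume U: "openin X U \<and> e \<in> U"
        then have "eventually (\<lambda>k. \<forall>j. a k j \<in> U) sequentially" using fan by (simp add: metric_fan_def)
        from eventually_compose_filterlim[OF this f]
        show "eventually (\<lambda>i. a (f i) (h i) \<in> U) sequentially" by eventually_elim simp
      qed simp
      from limitin_ldiv[OF this lim]
      have "limitin X (\<lambda>i. s (f i) (m (f i, h i))) (ldiv e x) sequentially"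
        by (simp add: tp p_def aX mX)
      then show False using nocross[OF f, of "\<lambda>i. m (f i, h i)"] by simp
    next
      fix n and r :: "nat \<Rightarrow> nat"
      assume r: "strict_mono r" "\<forall>i. f (r i) = n"
      have lim': "limitin X (\<lambda>i. t (r i)) x sequentially"
        by (rule limitin_reindex[OF filterlim_subseq[OF r(1)] lim])
      from nat_seq_dichotomy[of "\<lambda>i. h (r i)"] show False
      proof (elim disjE exE conjE)
        assume hr: "filterlim (\<lambda>i. h (r i)) at_top sequentially"
        have "\<forall>i. t (r i) \<in> G n (h (r i))" using tp pG r(2) by simp
        from Gno[OF hr this] lim' show False by simp
      next
        fix j and r' :: "nat \<Rightarrow> nat"
        assume r': "strict_mono r'" "\<forall>i. h (r (r' i)) = j"
        have "t (r (r' i)) = p n j" for i using tp r(2) r'(2) by simp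
        from Hausdorff_limit_of_constant_subsequence[OF Hausdorff lim' r'(1) this pX]
        have "x = t (r (r' 0))" using tp r(2) r'(2) by simp
        then show False using t xA by simp
      qed
    qed
  qed
qed

text \<open>
  If no \<open>B n \<cdot> B n\<close> traps all sequences converging to \<open>e\<close>, there are sequences \<open>s n\<close> outside \<open>B n \<cdot> B n\<close> but
  inside some \<open>B (p n)\<close>. Let \<open>t i\<close> be a convergent crossing sequence, thinned so that the row of
  \<open>t (Suc i)\<close> is at least the \<open>p\<close>-value of the row of \<open>t i\<close>. Then \<open>ldiv (t i) (t (Suc i)) \<longrightarrow> e\<close> whatever the limit of
  \<open>t\<close> is, so \<open>t (Suc i) = t i \<cdot> ldiv (t i) (t (Suc i))\<close> falls into the product which it should avoid.
\<close>

lemma crossing_imp_product_barrier: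
  assumes cross: "crossing_property X e" and C: "closed_cs_star X e \<C>" and U: "openin X U" "e \<in> U"
  shows "\<exists>M\<in>finite_unions \<C>. prod_set M M \<subseteq> U \<and>
    (\<forall>t. limitin X t e sequentially \<longrightarrow> eventually (\<lambda>n. t n \<in> prod_set M M) sequentially)"
proof -
  obtain V where V: "openin X V" "e \<in> V" "\<forall>v\<in>V. \<forall>w\<in>V. v \<cdot> w \<in> U" using mul_nbhd_e[OF U] by auto
  obtain B :: "nat \<Rightarrow> 'a set" where B: "incseq B" "\<And>n. B n \<subseteq> V" "\<And>n. B n \<in> finite_unions \<C>"
    and Bcap: "\<forall>s. limitin X s e sequentially \<longrightarrow> (\<exists>n. eventually (\<lambda>k. s k \<in> B n) sequentially)"
    using cs_star_exhaustion[OF C V(1,2)] by auto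
  have Bmono: "B i \<subseteq> B j" if "i \<le> j" for i j using incseqD[OF B(1) that] .
  have BX: "B n \<subseteq> topspace X" for n using B(2)[of n] openin_subset[OF V(1)] by simp
  have "\<exists>n. \<forall>t. limitin X t e sequentially \<longrightarrow> eventually (\<lambda>k. t k \<in> prod_set (B n) (B n)) sequentially"
  proof (rule ccontr)
    assume no: "\<not> ?thesis"
    have "\<forall>n. \<exists>\<sigma>. limitin X (fst \<sigma>) e sequentially \<and> 
        (\<forall>k. fst \<sigma> k \<notin> prod_set (B n) (B n) \<and> fst \<sigma> k \<in> B (snd \<sigma>))"
    proof
      fix n
      from no obtain t where t: "limitin X t e sequentially"
        "\<not> eventually (\<lambda>k. t k \<in> prod_set (B n) (B n)) sequentially" by auto
      obtain p where p: "eventually (\<lambda>k. t k \<in> B p) sequentially" using Bcap t(1) by auto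
      have "\<exists>\<^sub>F k in sequentially. t k \<notin> prod_set (B n) (B n)" using t(2) by (simp add: not_eventually)
      then have "\<exists>\<^sub>F k in sequentially. t k \<notin> prod_set (B n) (B n) \<and> t k \<in> B p"
        using p by (rule frequently_eventually_frequently)
      then obtain r :: "nat \<Rightarrow> nat" where r: "strict_mono r" "\<forall>k. t (r k) \<notin> prod_set (B n) (B n) \<and> t (r k) \<in> B p"
        using subsequence_frequently[of "\<lambda>_ k. t k \<notin> prod_set (B n) (B n) \<and> t k \<in> B p"] by auto
      have "limitin X (\<lambda>k. t (r k)) e sequentially"
        by (rule limitin_reindex[OF filterlim_subseq[OF r(1)] t(1)])
      then show "\<exists>\<sigma>. limitin X (fst \<sigma>) e sequentially \<and> 
        (\<forall>k. fst \<sigma> k \<notin> prod_set (B n) (B n) \<and> fst \<sigma> k \<in> B (snd \<sigma>))"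
        using r(2) by (intro exI[of _ "(\<lambda>k. t (r k), p)"]) simp
    qed
    from choice[OF this] obtain \<sigma> where \<sigma>: "\<forall>n. limitin X (fst (\<sigma> n)) e sequentially \<and> 
        (\<forall>k. fst (\<sigma> n) k \<notin> prod_set (B n) (B n) \<and> fst (\<sigma> n) k \<in> B (snd (\<sigma> n)))" ..
    define s where "s n = fst (\<sigma> n)" for n
    define p where "p n = snd (\<sigma> n)" for n
    have s: "\<forall>n. limitin X (s n) e sequentially" and out: "\<And>n k. s n k \<notin> prod_set (B n) (B n)"
      and inp: "\<And>n k. s n k \<in> B (p n)" using \<sigma> by (simp_all add: s_def p_def)
    from crossing_propertyD[OF cross s] obtain g h z where
      g: "filterlim g at_top sequentially" and lim: "limitin X (\<lambda>i. s (g i) (h i)) z sequentially" by auto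
    \<comment> \<open>The thinning makes the row of each term dominate the level \<open>p\<close> of the preceding term.\<close>
    have "\<exists>r. \<forall>n. True \<and> (r n < r (Suc n) \<and> p (g (r n)) \<le> g (r (Suc n)))"
    proof (rule dependent_nat_choice)
      fix x n :: nat
      have "eventually (\<lambda>i. p (g x) \<le> g i) sequentially" using g by (simp add: filterlim_at_top)
      from eventually_happens[OF eventually_conj[OF eventually_gt_at_top[of x] this]]
      show "\<exists>y. True \<and> (x < y \<and> p (g x) \<le> g y)" by simp
    qed simp
    then obtain r :: "nat \<Rightarrow> nat" where "\<forall>n. r n < r (Suc n)" and rp: "\<forall>n. p (g (r n)) \<le> g (r (Suc n))" by auto
    then have r: "strict_mono r" by (simp add: strict_mono_Suc_iff)
    define t where "t i = s (g (r i)) (h (r i))" for i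
    have limt: "limitin X t z sequentially"
      unfolding t_def by (rule limitin_reindex[OF filterlim_subseq[OF r] lim])
    have z: "z \<in> topspace X" using limt by (rule limitin_topspace)
    have "limitin X (\<lambda>i. ldiv (t i) (t (Suc i))) e sequentially"
      using limitin_ldiv[OF limt limitin_sequentially_offset[OF limt, of 1]] z by simp
    then obtain b where b: "eventually (\<lambda>i. ldiv (t i) (t (Suc i)) \<in> B b) sequentially" using Bcap by auto
    have "filterlim (\<lambda>i. g (r (Suc i))) at_top sequentially"
      using filterlim_compose[OF g filterlim_compose[OF filterlim_subseq[OF r] filterlim_Suc]] .
    then have "eventually (\<lambda>i. b \<le> g (r (Suc i))) sequentially" by (simp add: filterlim_at_top)
    from eventually_happens[OF eventually_conj[OF this b]] obtain i where
      i: "b \<le> g (r (Suc i))" "ldiv (t i) (t (Suc i)) \<in> B b" by auto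
    have "t i \<in> B (g (r (Suc i)))" using inp[of "g (r i)" "h (r i)"] Bmono[OF rp[rule_format, of i]] by (auto simp: t_def)
    moreover have "ldiv (t i) (t (Suc i)) \<in> B (g (r (Suc i)))" using Bmono[OF i(1)] i(2) by auto
    ultimately have "t i \<cdot> ldiv (t i) (t (Suc i)) \<in> prod_set (B (g (r (Suc i)))) (B (g (r (Suc i))))"
      by (rule prod_setI)
    moreover have "t k \<in> topspace X" for k using inp[of "g (r k)" "h (r k)"] BX by (auto simp: t_def)
    ultimately have "t (Suc i) \<in> prod_set (B (g (r (Suc i)))) (B (g (r (Suc i))))" by simp
    then show False using out by (simp add: t_def)
  qed
  then obtain n where n: "\<forall>t. limitin X t e sequentially \<longrightarrow> eventually (\<lambda>k. t k \<in> prod_set (B n) (B n)) sequentially" ..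
  have "prod_set (B n) (B n) \<subseteq> U" using V(3) B(2)[of n] by (auto simp: prod_set_def)
  then show ?thesis using n B(3) by (intro bexI[of _ "B n"]) auto
qed

definition nbhd_base_e :: "'a set set \<Rightarrow> bool" where
  "nbhd_base_e \<V> \<longleftrightarrow> countable \<V> \<and> (\<forall>V\<in>\<V>. openin X V \<and> e \<in> V) \<and>
     (\<forall>U. openin X U \<longrightarrow> e \<in> U \<longrightarrow> (\<exists>V\<in>\<V>. V \<subseteq> U))"

text \<open>
  With a decreasing sequence of traps \<open>W k\<close> the space is Frechet-Urysohn: for \<open>\<sigma> n m \<longrightarrow> y n\<close> and \<open>y n \<longrightarrow> x\<close>, the
  quotients \<open>ldiv (y n) (\<sigma> n m)\<close> tend to \<open>e\<close> for each \<open>n\<close>, and choosing them in \<open>W n\<close> gives a diagonal sequence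
  converging to \<open>x\<close>. Hence each trap is a neighbourhood of \<open>e\<close>, since a point of the closure of its
  complement would be a limit of a sequence in the complement.
\<close>

lemma nbhd_base_from_barriers:
  assumes cW: "countable \<W>"
    and bar: "\<And>W t. \<lbrakk>W \<in> \<W>; limitin X t e sequentially\<rbrakk> \<Longrightarrow> eventually (\<lambda>n. t n \<in> W) sequentially"
    and small: "\<And>U. \<lbrakk>openin X U; e \<in> U\<rbrakk> \<Longrightarrow> \<exists>W\<in>\<W>. W \<subseteq> U"
  shows "\<exists>\<V>. nbhd_base_e \<V>"
proof -
  have "\<W> \<noteq> {}" using small[OF openin_topspace] by auto
  then obtain w :: "nat \<Rightarrow> 'a set" where w: "range w = \<W>" using range_from_nat_into cW by metis
  define W where "W k = \<Inter>(w ` {..k})" for k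
  have wbar: "eventually (\<lambda>n. t n \<in> w i) sequentially" if "limitin X t e sequentially" for t i
    using bar[OF _ that, of "w i"] w by auto
  have Wbar: "eventually (\<lambda>n. t n \<in> W k) sequentially" if "limitin X t e sequentially" for t k
    unfolding W_def using wbar[OF that] by (simp add: eventually_ball_finite)
  have Wsmall: "\<exists>k. \<forall>n\<ge>k. W n \<subseteq> U" if U: "openin X U" "e \<in> U" for U
  proof -
    obtain i where i: "w i \<subseteq> U" using small[OF U] w by auto
    then have "W n \<subseteq> U" if "i \<le> n" for n using that i unfolding W_def by auto
    then show ?thesis by (intro exI[of _ i]) simp
  qed
  \<comment> \<open>The set \<open>L A\<close> of the limits of sequences in \<open>A\<close> is the first step of the sequential closure.\<close>
  define L where "L A = {x. \<exists>s. (\<forall>n::nat. s n \<in> A) \<and> limitin X s x sequentially}" for A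
  have closedL: "closedin X (L A)" if AX: "A \<subseteq> topspace X" for A
  proof (rule sequential_space_closedI[OF sequential])
    show "L A \<subseteq> topspace X" unfolding L_def using limitin_topspace by auto
    fix y x assume yL: "\<And>n::nat. y n \<in> L A" and lim: "limitin X y x sequentially"
    have "\<forall>n. \<exists>\<sigma>. (\<forall>m::nat. \<sigma> m \<in> A) \<and> limitin X \<sigma> (y n) sequentially" using yL by (simp add: L_def)
    from choice[OF this] obtain \<sigma> where \<sigma>: "\<forall>n. (\<forall>m::nat. \<sigma> n m \<in> A) \<and> limitin X (\<sigma> n) (y n) sequentially" ..
    have yX: "y n \<in> topspace X" for n using \<sigma> limitin_topspace by metis
    have "\<forall>n. \<exists>m. ldiv (y n) (\<sigma> n m) \<in> W n"
    proof
      fix n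
      have "limitin X (\<lambda>m::nat. y n) (y n) sequentially" using yX by simp
      from limitin_ldiv[OF this \<sigma>[THEN spec, of n, THEN conjunct2]]
      have "limitin X (\<lambda>m. ldiv (y n) (\<sigma> n m)) e sequentially" using yX[of n] by simp
      from eventually_happens[OF Wbar[OF this]] show "\<exists>m. ldiv (y n) (\<sigma> n m) \<in> W n" by simp
    qed
    from choice[OF this] obtain m where m: "\<forall>n. ldiv (y n) (\<sigma> n (m n)) \<in> W n" ..
    have "limitin X (\<lambda>n. ldiv (y n) (\<sigma> n (m n))) e sequentially"
      unfolding limitin_sequentially
    proof (intro conjI allI impI)
      fix U assume U: "openin X U \<and> e \<in> U"
      then obtain k where "\<forall>n\<ge>k. W n \<subseteq> U" using Wsmall by auto
      then have "\<forall>n. k \<le> n \<longrightarrow> ldiv (y n) (\<sigma> n (m n)) \<in> U" using m by auto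
      then show "\<exists>k. \<forall>n. k \<le> n \<longrightarrow> ldiv (y n) (\<sigma> n (m n)) \<in> U" ..
    qed simp
    from limitin_mul[OF lim this] have "limitin X (\<lambda>n. y n \<cdot> ldiv (y n) (\<sigma> n (m n))) x sequentially"
      using limitin_topspace[OF lim] by simp
    moreover have "\<sigma> n k \<in> topspace X" for n k using \<sigma> AX by auto
    ultimately have "limitin X (\<lambda>n. \<sigma> n (m n)) x sequentially" using yX by simp
    then show "x \<in> L A" unfolding L_def
      using \<sigma> by (intro CollectI exI[of _ "\<lambda>n. \<sigma> n (m n)"]) simp
  qed
  have eW: "e \<in> X interior_of (W k)" for k
  proof (rule ccontr)
    assume "e \<notin> X interior_of (W k)"
    then have "e \<in> X closure_of (topspace X - W k)" by (simp add: interior_of_closure_of)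
    moreover have "topspace X - W k \<subseteq> L (topspace X - W k)"
    proof
      fix x assume "x \<in> topspace X - W k"
      then show "x \<in> L (topspace X - W k)" unfolding L_def by (intro CollectI exI[of _ "\<lambda>_. x"]) simp
    qed
    then have "X closure_of (topspace X - W k) \<subseteq> L (topspace X - W k)"
      by (rule closure_of_minimal) (rule closedL, simp)
    ultimately have "e \<in> L (topspace X - W k)" by auto
    then obtain s where s: "\<forall>n::nat. s n \<in> topspace X - W k" "limitin X s e sequentially" unfolding L_def by auto
    from eventually_happens[OF Wbar[OF s(2)]] s(1) show False by auto
  qed
  have "nbhd_base_e (range (\<lambda>k. X interior_of (W k)))"
    unfolding nbhd_base_e_def
  proof (intro conjI allI impI)
    fix U assume "openin X U" "e \<in> U"
    from Wsmall[OF this] obtain k where "W k \<subseteq> U" by auto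
    then have "X interior_of (W k) \<subseteq> U" using interior_of_subset[of X "W k"] by simp
    then show "\<exists>V\<in>range (\<lambda>k. X interior_of (W k)). V \<subseteq> U" by auto
  qed (use eW in auto)
  then show ?thesis by auto
qed

lemma crossing_imp_nbhd_base:
  assumes "crossing_property X e" "closed_cs_star X e \<C>"
  shows "\<exists>\<V>. nbhd_base_e \<V>"
proof -
  define \<W> where "\<W> = {W \<in> (\<lambda>M. prod_set M M) ` finite_unions \<C>.
    \<forall>t. limitin X t e sequentially \<longrightarrow> eventually (\<lambda>n. t n \<in> W) sequentially}"
  show ?thesis
  proof (rule nbhd_base_from_barriers[of \<W>])
    show "countable \<W>"
      using assms(2) countable_finite_unions[of \<C>] by (simp add: \<W>_def closed_cs_star_def)
    show "eventually (\<lambda>n. t n \<in> W) sequentially" if "W \<in> \<W>" "limitin X t e sequentially" for W t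
      using that by (simp add: \<W>_def)
    show "\<exists>W\<in>\<W>. W \<subseteq> U" if "openin X U" "e \<in> U" for U
      using crossing_imp_product_barrier[OF assms that] by (auto simp: \<W>_def)
  qed
qed

text \<open>
  For every basic \<open>V\<close>, countably many \<open>d\<close> suffice to have \<open>ldiv x d \<in> V\<close> for some \<open>d\<close>, whatever \<open>x\<close> is; then
  \<open>d = x \<cdot> ldiv x d\<close> is close to \<open>x\<close>.
\<close>

lemma Lindelof_imp_separable:
  assumes Lin: "Lindelof_space X" and V: "nbhd_base_e \<V>"
  shows "separable_space X"
proof -
  define G where "G V d = {x \<in> topspace X. ldiv x d \<in> V}" for V d
  have "\<forall>V\<in>\<V>. \<exists>D. countable D \<and> D \<subseteq> topspace X \<and> topspace X \<subseteq> \<Union>(G V ` D)"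
  proof
    fix V assume "V \<in> \<V>"
    then have V1: "openin X V" "e \<in> V" using V by (auto simp: nbhd_base_e_def)
    have "\<exists>\<U>. countable \<U> \<and> \<U> \<subseteq> G V ` topspace X \<and> \<Union>\<U> = topspace X"
    proof (rule Lindelof_spaceD[OF Lin])
      show "openin X U" if "U \<in> G V ` topspace X" for U
        using that openin_ldiv_left[OF V1(1)] by (auto simp: G_def)
      show "\<Union>(G V ` topspace X) = topspace X"
      proof
        show "\<Union>(G V ` topspace X) \<subseteq> topspace X" by (auto simp: G_def)
        show "topspace X \<subseteq> \<Union>(G V ` topspace X)"
        proof
          fix x assume x: "x \<in> topspace X"
          then have "x \<in> G V x" using V1(2) by (simp add: G_def)
          then show "x \<in> \<Union>(G V ` topspace X)" using x by auto
        qed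
      qed
    qed
    then obtain \<U> where U: "countable \<U>" "\<U> \<subseteq> G V ` topspace X" "\<Union>\<U> = topspace X" by metis
    then obtain D where "countable D" "D \<subseteq> topspace X" "\<U> = G V ` D"
      using countable_subset_image[of \<U> "G V" "topspace X"] by auto
    then show "\<exists>D. countable D \<and> D \<subseteq> topspace X \<and> topspace X \<subseteq> \<Union>(G V ` D)"
      using U(3) by (intro exI[of _ D]) simp
  qed
  from bchoice[OF this] obtain D where D: "\<forall>V\<in>\<V>. countable (D V) \<and> D V \<subseteq> topspace X \<and> topspace X \<subseteq> \<Union>(G V ` D V)" ..
  define E where "E = (\<Union>V\<in>\<V>. D V)"
  have "countable E" unfolding E_def using V D by (simp add: nbhd_base_e_def)
  moreover have EX: "E \<subseteq> topspace X" unfolding E_def using D by auto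
  moreover have "X closure_of E = topspace X"
  proof
    show "X closure_of E \<subseteq> topspace X" by (rule closure_of_subset_topspace)
    show "topspace X \<subseteq> X closure_of E"
    proof
      fix x assume x: "x \<in> topspace X"
      show "x \<in> X closure_of E"
        unfolding in_closure_of
      proof (intro conjI allI impI)
        show "x \<in> topspace X" by fact
        fix U assume U: "x \<in> U \<and> openin X U"
        then obtain A B where AB: "openin X B" "x \<in> A" "e \<in> B" "\<forall>v\<in>A. \<forall>w\<in>B. v \<cdot> w \<in> U"
          using mul_open_nbhds[of U x e] x by auto
        obtain V1 where V1: "V1 \<in> \<V>" "V1 \<subseteq> B" using V AB(1,3) by (auto simp: nbhd_base_e_def)
        then obtain d where d: "d \<in> D V1" "x \<in> G V1 d" using D x by blast
        have dX: "d \<in> topspace X" using D V1(1) d(1) by auto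
        have "x \<cdot> ldiv x d \<in> U" using AB(2,4) d(2) V1(2) by (auto simp: G_def)
        then have "d \<in> U" using x dX by simp
        then show "\<exists>y. y \<in> E \<and> y \<in> U" using d(1) V1(1) by (auto simp: E_def)
      qed
    qed
  qed
  ultimately show ?thesis unfolding separable_space_def by auto
qed

text \<open>
  The translates of the basic neighbourhoods of \<open>e\<close> by points of a dense set form a base: \<open>d \<cdot> V\<close> contains \<open>x\<close>
  iff \<open>ldiv d x \<in> V\<close>, which holds for \<open>d\<close> near \<open>x\<close>.
\<close>

lemma separable_imp_second_countable:
  assumes sep: "separable_space X" and V: "nbhd_base_e \<V>"
  shows "second_countable X"
proof -
  obtain D where D: "countable D" "D \<subseteq> topspace X" "X closure_of D = topspace X"
    using sep unfolding separable_space_def by auto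
  define T where "T d V = {y \<in> topspace X. ldiv d y \<in> V}" for d V
  define \<B> where "\<B> = (\<lambda>(d, V). T d V) ` (D \<times> \<V>)"
  have "countable \<B>" unfolding \<B>_def using D(1) V by (simp add: nbhd_base_e_def)
  moreover have "openin X B" if "B \<in> \<B>" for B
    using that D(2) V openin_ldiv_right by (auto simp: \<B>_def T_def nbhd_base_e_def subset_iff)
  moreover have "\<exists>B\<in>\<B>. x \<in> B \<and> B \<subseteq> U" if U: "openin X U" "x \<in> U" for x U
  proof -
    have x: "x \<in> topspace X" using openin_subset[OF U(1)] U(2) by auto
    obtain A B where AB: "openin X A" "openin X B" "x \<in> A" "e \<in> B" "\<forall>v\<in>A. \<forall>w\<in>B. v \<cdot> w \<in> U"
      using mul_open_nbhds[of U x e] x U by auto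
    obtain V1 where V1: "V1 \<in> \<V>" "V1 \<subseteq> B" "openin X V1" "e \<in> V1" using V AB(2,4) by (auto simp: nbhd_base_e_def)
    define S where "S = A \<inter> {y \<in> topspace X. ldiv y x \<in> V1}"
    have "openin X S" unfolding S_def by (intro openin_Int AB(1) openin_ldiv_left V1(3) x)
    moreover have "x \<in> S" using x AB(3) V1(4) by (simp add: S_def)
    moreover have "x \<in> X closure_of D" using D(3) x by simp
    ultimately obtain d where d: "d \<in> D" "d \<in> S" unfolding in_closure_of by auto
    have dX: "d \<in> topspace X" using d(1) D(2) by auto
    have "T d V1 \<subseteq> U"
    proof
      fix y assume "y \<in> T d V1"
      then have y: "y \<in> topspace X" "ldiv d y \<in> B" using V1(2) by (auto simp: T_def)
      have "d \<in> A" using d(2) by (simp add: S_def)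
      then have "d \<cdot> ldiv d y \<in> U" using AB(5) y(2) by blast
      then show "y \<in> U" using y(1) dX by simp
    qed
    moreover have "x \<in> T d V1" using d(2) x by (simp add: S_def T_def)
    moreover have "T d V1 \<in> \<B>" unfolding \<B>_def using d(1) V1(1) by (intro image_eqI[of _ _ "(d, V1)"]) simp_all
    ultimately show ?thesis by auto
  qed
  ultimately show ?thesis unfolding second_countable_def by (intro exI[of _ \<B>]) simp
qed

end

section \<open>Pytkeev networks, k-networks and cs*-networks\<close>

lemma compactin_infinite_accumulates:
  assumes K: "compactin X K" and A: "A \<subseteq> K" "infinite A"
  shows "\<exists>y\<in>K. accumulates_at X A y"
proof (rule ccontr)
  assume "\<not> ?thesis"
  then have "\<forall>y\<in>K. \<exists>U. openin X U \<and> y \<in> U \<and> finite (U \<inter> A)" unfolding accumulates_at_def by auto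
  from bchoice[OF this] obtain U where U: "\<forall>y\<in>K. openin X (U y) \<and> y \<in> U y \<and> finite (U y \<inter> A)" ..
  have "(\<forall>V\<in>U ` K. openin X V) \<and> K \<subseteq> \<Union>(U ` K)" using U by auto
  then obtain \<F> where F: "finite \<F>" "\<F> \<subseteq> U ` K" "K \<subseteq> \<Union>\<F>" using K unfolding compactin_def by metis
  have "finite (V \<inter> A)" if "V \<in> \<F>" for V using that F(2) U by auto
  then have fin: "finite (\<Union>V\<in>\<F>. V \<inter> A)" by (rule finite_UN_I[OF F(1)])
  have "A \<subseteq> (\<Union>V\<in>\<F>. V \<inter> A)" using A(1) F(3) by auto
  from finite_subset[OF this fin] A(2) show False by simp
qed

text \<open>
  If no finite part of the network elements inside \<open>U\<close> covered \<open>K\<close>, points \<open>x n \<in> K\<close> outside the first \<open>n\<close>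
  elements would form an infinite subset of \<open>K\<close> meeting each element in a finite set, yet it accumulates
  at a point of \<open>K\<close>.
\<close>

lemma P0_imp_aleph0:
  assumes "P0_space X"
  shows "aleph0_space X"
proof -
  obtain \<N> where T3: "T3_space X" and cN: "countable \<N>" and N: "Pytkeev_network X \<N>"
    using assms unfolding P0_space_def by auto
  have pyt: "Pytkeev_network_at X \<N> x" if "x \<in> topspace X" for x using N that unfolding Pytkeev_network_def by simp
  have "k_network X \<N>"
    unfolding k_network_def
  proof (intro conjI allI impI)
    show "\<N> \<subseteq> Pow (topspace X)" using N by (simp add: Pytkeev_network_def)
    fix U K assume UK: "openin X U \<and> compactin X K \<and> K \<subseteq> U"
    have KX: "K \<subseteq> topspace X" using UK compactin_subset_topspace by metis
    define \<W> where "\<W> = {N\<in>\<N>. N \<subseteq> U}"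
    have cov: "\<exists>N\<in>\<W>. x \<in> N" if "x \<in> K" for x
    proof -
      have "network_at X \<N> x" using pyt[of x] that KX by (auto simp: Pytkeev_network_at_def)
      then show ?thesis using UK that unfolding network_at_def \<W>_def by auto
    qed
    show "\<exists>\<F>. finite \<F> \<and> \<F> \<subseteq> \<N> \<and> K \<subseteq> \<Union>\<F> \<and> \<Union>\<F> \<subseteq> U"
    proof (cases "\<W> = {}")
      case True
      then have "K = {}" using cov by auto
      then show ?thesis by (intro exI[of _ "{}"]) simp
    next
      case False
      have "countable \<W>" using cN by (simp add: \<W>_def)
      then obtain g :: "nat \<Rightarrow> 'a set" where g: "range g = \<W>" using False range_from_nat_into by metis
      show ?thesis
      proof (rule ccontr)
        assume no: "\<not> ?thesis"
        have "\<exists>x. x \<in> K \<and> x \<notin> \<Union>(g ` {..n})" for n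
        proof (rule ccontr)
          assume "\<not> ?thesis"
          then have "K \<subseteq> \<Union>(g ` {..n})" by auto
          moreover have "g ` {..n} \<subseteq> \<N>" "\<Union>(g ` {..n}) \<subseteq> U" using g unfolding \<W>_def by auto
          ultimately have "\<exists>\<F>. finite \<F> \<and> \<F> \<subseteq> \<N> \<and> K \<subseteq> \<Union>\<F> \<and> \<Union>\<F> \<subseteq> U"
            by (intro exI[of _ "g ` {..n}"]) simp
          with no show False by (rule notE)
        qed
        then have "\<forall>n. \<exists>x. x \<in> K \<and> x \<notin> \<Union>(g ` {..n})" by simp
        from choice[OF this] obtain x where x: "\<forall>n. x n \<in> K \<and> x n \<notin> \<Union>(g ` {..n})" ..
        have xg: "n < m" if xm: "x n \<in> g m" for n m
        proof (rule ccontr)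
          assume "\<not> n < m"
          then have "x n \<in> \<Union>(g ` {..n})" using xm by auto
          then show False using x by simp
        qed
        have "infinite (range x)"
        proof
          assume fin: "finite (range x)"
          have "\<exists>m. x n \<in> g m" for n using cov[of "x n"] x g by auto
          then have "\<forall>y\<in>range x. \<exists>m. y \<in> g m" by auto
          from bchoice[OF this] obtain f where f: "\<forall>y\<in>range x. y \<in> g (f y)" ..
          have "finite (f ` range x)" using fin by (rule finite_imageI)
          then obtain B where "\<forall>m\<in>f ` range x. m \<le> B" unfolding finite_nat_set_iff_bounded_le ..
          then have "f (x B) \<le> B" by simp
          moreover have "B < f (x B)" by (rule xg) (use f in simp)
          ultimately show False by simp
        qed
        moreover have "range x \<subseteq> K" using x by auto
        ultimately obtain y where y: "y \<in> K" "accumulates_at X (range x) y"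
          using compactin_infinite_accumulates[of X K "range x"] UK by auto
        have "range x \<subseteq> topspace X" using \<open>range x \<subseteq> K\<close> KX by simp
        moreover have "Pytkeev_network_at X \<N> y" using pyt y(1) KX by auto
        ultimately have "\<exists>N\<in>\<N>. N \<subseteq> U \<and> infinite (N \<inter> range x)"
          using UK y unfolding Pytkeev_network_at_def by blast
        then obtain M where M: "M \<in> \<N>" "M \<subseteq> U" "infinite (M \<inter> range x)" by auto
        then have "M \<in> \<W>" by (simp add: \<W>_def)
        then obtain m where m: "M = g m" using g by auto
        have "M \<inter> range x \<subseteq> x ` {..<m}" using xg m by auto
        then show False using M(3) finite_subset[of "M \<inter> range x" "x ` {..<m}"] by simp
      qed
    qed
  qed
  then show ?thesis using T3 cN unfolding aleph0_space_def by auto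
qed

lemma P0_imp_separable_strong_Pytkeev:
  assumes "P0_space X"
  shows "separable_space X \<and> strong_Pytkeev_property X"
proof -
  obtain \<N> where cN: "countable \<N>" and N: "Pytkeev_network X \<N>"
    using assms unfolding P0_space_def by auto
  define D where "D = (\<lambda>N. SOME x. x \<in> N) ` {N\<in>\<N>. N \<noteq> {}}"
  have some: "(SOME x. x \<in> N) \<in> N" if "N \<noteq> {}" for N :: "'a set" using that by (simp add: some_in_eq)
  have "countable D" unfolding D_def using cN by simp
  moreover have "D \<subseteq> topspace X" unfolding D_def using some N by (auto simp: Pytkeev_network_def)
  moreover have "topspace X \<subseteq> X closure_of D"
  proof
    fix x assume x: "x \<in> topspace X"
    show "x \<in> X closure_of D" unfolding in_closure_of
    proof (intro conjI allI impI)
      fix U assume U: "x \<in> U \<and> openin X U"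
      have "network_at X \<N> x" using N x by (simp add: Pytkeev_network_def Pytkeev_network_at_def)
      then obtain M where "M \<in> \<N>" "x \<in> M" "M \<subseteq> U" using U unfolding network_at_def by auto
      then show "\<exists>y. y \<in> D \<and> y \<in> U" unfolding D_def using some[of M] by blast
    qed (fact x)
  qed
  ultimately have "separable_space X" unfolding separable_space_def
    using closure_of_subset_topspace[of X D] by (intro exI[of _ D]) auto
  then show ?thesis using cN N unfolding strong_Pytkeev_property_def Pytkeev_network_def by auto
qed

lemma network_imp_Lindelof:
  assumes "countable \<D>" "network_on X (topspace X) \<D>"
  shows "Lindelof_space X"
  unfolding Lindelof_space_alt
proof (intro allI impI)
  fix \<U> assume U: "(\<forall>U\<in>\<U>. openin X U) \<and> topspace X \<subseteq> \<Union>\<U>"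
  define \<M> where "\<M> = {N\<in>\<D>. \<exists>U\<in>\<U>. N \<subseteq> U}"
  have "\<forall>N\<in>\<M>. \<exists>U. U \<in> \<U> \<and> N \<subseteq> U" by (auto simp: \<M>_def)
  from bchoice[OF this] obtain f where f: "\<forall>N\<in>\<M>. f N \<in> \<U> \<and> N \<subseteq> f N" ..
  have "topspace X \<subseteq> \<Union>(f ` \<M>)"
  proof
    fix x assume x: "x \<in> topspace X"
    then obtain V where V: "V \<in> \<U>" "x \<in> V" using U by auto
    from network_onD[OF assms(2) x] U V obtain N where N: "N \<in> \<D>" "x \<in> N" "N \<subseteq> V" by blast
    then have "N \<in> \<M>" using V(1) by (auto simp: \<M>_def)
    then show "x \<in> \<Union>(f ` \<M>)" using f N(2) by auto
  qed
  moreover have "countable (f ` \<M>)" using assms(1) by (simp add: \<M>_def)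
  moreover have "f ` \<M> \<subseteq> \<U>" using f by auto
  ultimately show "\<exists>\<V>. countable \<V> \<and> \<V> \<subseteq> \<U> \<and> topspace X \<subseteq> \<Union>\<V>" by (intro exI[of _ "f ` \<M>"]) simp
qed

lemma k_network_imp_cs_star_network_at:
  assumes N: "k_network X \<N>"
  shows "cs_star_network_at X \<N> x"
  unfolding cs_star_network_at_def
proof (intro conjI allI impI)
  show "\<N> \<subseteq> Pow (topspace X)" using N by (simp add: k_network_def)
  fix s U assume H: "(\<forall>n::nat. s n \<in> topspace X) \<and> limitin X s x sequentially \<and> openin X U \<and> x \<in> U"
  then obtain n0 where n0: "\<forall>n\<ge>n0. s n \<in> U" unfolding limitin_sequentially by metis
  have "compactin X (insert x (s ` {n0..}))"
    by (rule compactin_sequence_with_limit) (use H in auto)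
  moreover have "insert x (s ` {n0..}) \<subseteq> U" using H n0 by auto
  ultimately obtain \<F> where F: "finite \<F>" "\<F> \<subseteq> \<N>" "insert x (s ` {n0..}) \<subseteq> \<Union>\<F>" "\<Union>\<F> \<subseteq> U"
    using N H unfolding k_network_def by metis
  have "\<exists>M\<in>\<F>. infinite {n\<in>{n0..}. s n \<in> M}"
    by (rule pigeonhole_infinite_rel[OF infinite_Ici F(1)]) (use F(3) in auto)
  then obtain M where M: "M \<in> \<F>" "infinite {n\<in>{n0..}. s n \<in> M}" ..
  have "infinite {n. s n \<in> M}" by (rule infinite_super[OF _ M(2)]) auto
  then show "\<exists>N\<in>\<N>. N \<subseteq> U \<and> infinite {n. s n \<in> N}" using M(1) F(2,4) by auto
qed

lemma aleph0_imp_Lindelof_cs_star: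
  assumes "aleph0_space X"
  shows "Lindelof_space X \<and> countable_cs_star_character X"
proof -
  obtain \<N> where cN: "countable \<N>" and N: "k_network X \<N>" using assms unfolding aleph0_space_def by auto
  have "network_on X (topspace X) \<N>"
    unfolding network_on_def
  proof (intro ballI allI impI)
    fix x U assume "x \<in> topspace X" "openin X U" "x \<in> U"
    moreover from this have "compactin X {x}" by simp
    ultimately obtain \<F> where "\<F> \<subseteq> \<N>" "{x} \<subseteq> \<Union>\<F>" "\<Union>\<F> \<subseteq> U" 
      using N unfolding k_network_def by (metis empty_subsetI insert_subset)
    then show "\<exists>N\<in>\<N>. x \<in> N \<and> N \<subseteq> U" by auto
  qed
  then have "Lindelof_space X" by (rule network_imp_Lindelof[OF cN])
  moreover have "countable_cs_star_character X"
    unfolding countable_cs_star_character_def using cN k_network_imp_cs_star_network_at[OF N] by auto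
  ultimately show ?thesis ..
qed

text \<open>
  If the range of the sequence does not accumulate at the limit, then almost all terms take finitely many
  values; one value is taken infinitely often and equals the limit.
\<close>

lemma Pytkeev_imp_cs_star_network_at:
  assumes H: "Hausdorff_space X" and N: "Pytkeev_network_at X \<N> x"
  shows "cs_star_network_at X \<N> x"
  unfolding cs_star_network_at_def
proof (intro conjI allI impI)
  have net: "network_at X \<N> x" using N by (simp add: Pytkeev_network_at_def)
  then show "\<N> \<subseteq> Pow (topspace X)" by (simp add: network_at_def)
  fix s U assume A: "(\<forall>n::nat. s n \<in> topspace X) \<and> limitin X s x sequentially \<and> openin X U \<and> x \<in> U"
  show "\<exists>N\<in>\<N>. N \<subseteq> U \<and> infinite {n. s n \<in> N}"
  proof (cases "accumulates_at X (range s) x")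
    case True
    then have "\<exists>N\<in>\<N>. N \<subseteq> U \<and> infinite (N \<inter> range s)"
      using N A unfolding Pytkeev_network_at_def by (metis image_subsetI)
    then obtain M where M: "M \<in> \<N>" "M \<subseteq> U" "infinite (M \<inter> range s)" by auto
    have "M \<inter> range s \<subseteq> s ` {n. s n \<in> M}" by auto
    then have "infinite {n. s n \<in> M}" using M(3) finite_subset[of "M \<inter> range s"] by auto
    then show ?thesis using M by auto
  next
    case False
    then obtain V where V: "openin X V" "x \<in> V" "finite (V \<inter> range s)" unfolding accumulates_at_def by auto
    obtain k where k: "\<forall>n\<ge>k. s n \<in> V" using A V(1,2) unfolding limitin_sequentially by metis
    then have "s ` {k..} \<subseteq> V \<inter> range s" by auto
    then have "finite (s ` {k..})" using V(3) by (rule finite_subset)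
    from pigeonhole_infinite[OF infinite_Ici this] obtain c where
      c: "infinite {n\<in>{k..}. s n = s c}" by auto
    from infinite_enumerate[OF c] obtain r :: "nat \<Rightarrow> nat" where
      r: "strict_mono r" "\<And>n. s (r n) = s c" by auto
    have "x = s c"
      by (rule Hausdorff_limit_of_constant_subsequence[where X=X and s=s and r=r])
         (use H A r in auto)
    then have inf: "infinite {n. s n = x}" using infinite_super[OF _ c, of "{n. s n = x}"] by auto
    obtain M where M: "M \<in> \<N>" "x \<in> M" "M \<subseteq> U" using net A unfolding network_at_def by auto
    then have "{n. s n = x} \<subseteq> {n. s n \<in> M}" by auto
    from infinite_super[OF this inf] have "infinite {n. s n \<in> M}" .
    then show ?thesis using M by auto
  qed
qed

lemma second_countable_imp_P0:
  assumes "T3_space X" "second_countable X"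
  shows "P0_space X"
proof -
  obtain \<B> where B: "countable \<B>" "\<forall>V\<in>\<B>. openin X V"
    and base: "\<forall>U x. openin X U \<and> x \<in> U \<longrightarrow> (\<exists>V\<in>\<B>. x \<in> V \<and> V \<subseteq> U)"
    using assms(2) unfolding second_countable_def by auto
  have sub: "\<B> \<subseteq> Pow (topspace X)" using B(2) openin_subset by auto
  have "Pytkeev_network_at X \<B> x" for x
    unfolding Pytkeev_network_at_def network_at_def
  proof (intro conjI allI impI)
    show "\<exists>N\<in>\<B>. x \<in> N \<and> N \<subseteq> U" if "openin X U \<and> x \<in> U" for U using base that by blast
    fix U A assume A: "openin X U \<and> x \<in> U \<and> A \<subseteq> topspace X \<and> accumulates_at X A x"
    then obtain V where V: "V \<in> \<B>" "x \<in> V" "V \<subseteq> U" using base by blast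
    then have "infinite (V \<inter> A)" using A B(2) unfolding accumulates_at_def by blast
    then show "\<exists>N\<in>\<B>. N \<subseteq> U \<and> infinite (N \<inter> A)" using V by auto
  qed (fact sub)
  then show ?thesis unfolding P0_space_def Pytkeev_network_def using assms(1) B(1) sub by auto
qed

section \<open>Pytkeev networks of submetrizable k-omega spaces\<close>

text \<open>
  A continuous metric induces the topology of a compact set \<open>C\<close>: the distance from \<open>y\<close> is bounded away from
  zero on the compact set \<open>C - U\<close>. Finite covers of \<open>C\<close> by small balls then form a base.
\<close>

lemma compactin_countable_base:
  assumes d: "Metric_space (topspace X) d"
    and cont: "continuous_map (prod_topology X X) euclideanreal (\<lambda>(x, y). d x y)"
    and C: "compactin X C"
  shows "\<exists>\<B>. countable \<B> \<and> (\<forall>N\<in>\<B>. \<exists>V. openin X V \<and> N = C \<inter> V) \<and> network_on X C \<B>"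
proof -
  interpret Metric_space "topspace X" d by (rule d)
  have CX: "C \<subseteq> topspace X" using C by (rule compactin_subset_topspace)
  have contd: "continuous_map X euclideanreal (d x)" if "x \<in> topspace X" for x
  proof -
    have "continuous_map X (prod_topology X X) (\<lambda>y. (x, y))" using that by (simp add: continuous_map_paired)
    from continuous_map_compose[OF this cont] show ?thesis by (simp add: o_def)
  qed
  define \<epsilon> where "\<epsilon> k = inverse (real (Suc k))" for k
  define b where "b c k = {y \<in> topspace X. d c y \<in> {..<\<epsilon> k}}" for c k
  have b_open: "openin X (b c k)" if "c \<in> topspace X" for c k
    unfolding b_def by (rule openin_continuous_map_preimage[OF contd[OF that]]) simp
  have "\<forall>k. \<exists>F. finite F \<and> F \<subseteq> C \<and> C \<subseteq> (\<Union>c\<in>F. b c k)"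
  proof
    fix k
    have "c \<in> b c k" if "c \<in> C" for c using that CX by (auto simp: b_def \<epsilon>_def)
    then have "(\<forall>U\<in>(\<lambda>c. b c k) ` C. openin X U) \<and> C \<subseteq> \<Union>((\<lambda>c. b c k) ` C)" using b_open CX by auto
    then obtain \<F> where F: "finite \<F>" "\<F> \<subseteq> (\<lambda>c. b c k) ` C" "C \<subseteq> \<Union>\<F>" using C unfolding compactin_def by metis
    from finite_subset_image[OF F(1,2)] obtain F' where "F' \<subseteq> C" "finite F'" "\<F> = (\<lambda>c. b c k) ` F'" by auto
    then show "\<exists>F. finite F \<and> F \<subseteq> C \<and> C \<subseteq> (\<Union>c\<in>F. b c k)" using F(3) by (intro exI[of _ F']) simp
  qed
  from choice[OF this] obtain F where F: "\<forall>k. finite (F k) \<and> F k \<subseteq> C \<and> C \<subseteq> (\<Union>c\<in>F k. b c k)" ..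
  define \<B> where "\<B> = (\<Union>k. (\<lambda>c. C \<inter> b c k) ` F k)"
  have "countable \<B>" unfolding \<B>_def using F by (simp add: countable_finite)
  moreover have "\<forall>N\<in>\<B>. \<exists>V. openin X V \<and> N = C \<inter> V"
  proof
    fix N assume "N \<in> \<B>"
    then obtain k c where "c \<in> F k" "N = C \<inter> b c k" unfolding \<B>_def by auto
    moreover from this have "c \<in> topspace X" using F CX by blast
    ultimately show "\<exists>V. openin X V \<and> N = C \<inter> V" using b_open by (intro exI[of _ "b c k"]) simp
  qed
  moreover have "network_on X C \<B>"
    unfolding network_on_def
  proof (intro ballI allI impI)
    fix y U assume y: "y \<in> C" and U: "openin X U" "y \<in> U"
    have yX: "y \<in> topspace X" using y CX by auto
    \<comment> \<open>Twice the radius, because two points of one ball around \<open>c\<close> are compared through \<open>c\<close>.\<close>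
    define G where "G n = {z \<in> topspace X. d y z \<in> {2 * \<epsilon> n<..}}" for n
    have "closedin X (topspace X - U)" using U(1) by blast
    from closed_Int_compactin[OF this C] have cK: "compactin X ((topspace X - U) \<inter> C)" .
    have "z \<in> \<Union>(range G)" if z: "z \<in> (topspace X - U) \<inter> C" for z
    proof -
      have zX: "z \<in> topspace X" and "y \<noteq> z" using z U(2) by auto
      then have "0 < d y z / 2" using yX nonneg[of y z] zero[of y z] by (simp add: less_le)
      then obtain n where "inverse (real (Suc n)) < d y z / 2" using reals_Archimedean by metis
      then have "z \<in> G n" using zX by (simp add: G_def \<epsilon>_def)
      then show ?thesis by auto
    qed
    moreover have "openin X (G n)" for n
      unfolding G_def by (rule openin_continuous_map_preimage[OF contd[OF yX]]) simp
    ultimately have "(\<forall>V\<in>range G. openin X V) \<and> (topspace X - U) \<inter> C \<subseteq> \<Union>(range G)" by auto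
    then obtain \<F> where FF: "finite \<F>" "\<F> \<subseteq> range G" "(topspace X - U) \<inter> C \<subseteq> \<Union>\<F>"
      using cK unfolding compactin_def by metis
    from finite_subset_image[OF FF(1,2)] obtain I where I: "finite I" "\<F> = G ` I" by auto
    obtain n where n: "\<forall>i\<in>I. i \<le> n" using I(1) finite_nat_set_iff_bounded_le by auto
    have eps: "\<epsilon> n \<le> \<epsilon> i" if "i \<le> n" for i using that unfolding \<epsilon>_def by (intro le_imp_inverse_le) simp_all
    have far: "2 * \<epsilon> n < d y z" if "z \<in> C" "z \<notin> U" for z
    proof -
      have "z \<in> (topspace X - U) \<inter> C" using that CX by auto
      then obtain i where "i \<in> I" "z \<in> G i" using FF(3) I(2) by auto
      then show ?thesis using eps[of i] n by (auto simp: G_def)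
    qed
    obtain c where c: "c \<in> F n" "y \<in> b c n" using F y by blast
    have cX: "c \<in> topspace X" using c(1) F CX by blast
    have "C \<inter> b c n \<subseteq> U"
    proof (rule ccontr)
      assume "\<not> ?thesis"
      then obtain z where z: "z \<in> C" "z \<in> b c n" "z \<notin> U" by auto
      have "d y z \<le> d y c + d c z" using triangle[of y c z] yX cX z(1) CX by auto
      also have "\<dots> < \<epsilon> n + \<epsilon> n" using c(2) z(2) commute[of y c] by (intro add_strict_mono) (simp_all add: b_def)
      finally show False using far[OF z(1,3)] by simp
    qed
    moreover have "y \<in> C \<inter> b c n" using y c(2) by simp
    moreover have "C \<inter> b c n \<in> \<B>" unfolding \<B>_def using c(1) by auto
    ultimately show "\<exists>N\<in>\<B>. y \<in> N \<and> N \<subseteq> U" by auto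
  qed
  ultimately show ?thesis by auto
qed

text \<open>
  The countable bases of the compact pieces together form a Pytkeev network. Let \<open>A\<close> accumulate at \<open>x \<in> V\<close>. If
  \<open>A \<inter> V\<close> met each piece in a finite set, then \<open>A \<inter> V - {x}\<close> would be closed. So it meets some piece in an
  infinite set, which accumulates at a point \<open>y\<close> of that piece. As \<open>y\<close> may differ from \<open>x\<close>, the set \<open>V\<close> is
  taken with its closure in \<open>U\<close>, so that a basic neighbourhood of \<open>y\<close> still fits into \<open>U\<close>.
\<close>

lemma submetrizable_k_omega_imp_P0:
  assumes T3: "T3_space X" and "submetrizable_space X" "k_omega_space X"
  shows "P0_space X"
proof -
  have reg: "regular_space X" and t1: "t1_space X" using T3 by (auto simp: T3_space_def)
  obtain d where d: "Metric_space (topspace X) d"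
    "continuous_map (prod_topology X X) euclideanreal (\<lambda>(x, y). d x y)"
    using assms(2) unfolding submetrizable_space_def by auto
  obtain \<C> where C: "countable \<C>" "\<forall>C\<in>\<C>. compactin X C" "\<Union>\<C> = topspace X"
    and k: "\<forall>U. U \<subseteq> topspace X \<longrightarrow> (openin X U \<longleftrightarrow> (\<forall>C\<in>\<C>. openin (subtopology X C) (C \<inter> U)))"
    using assms(3) unfolding k_omega_space_def by auto
  have "\<forall>C\<in>\<C>. \<exists>\<B>. countable \<B> \<and> (\<forall>N\<in>\<B>. \<exists>V. openin X V \<and> N = C \<inter> V) \<and> network_on X C \<B>"
    using compactin_countable_base[OF d] C(2) by simp
  from bchoice[OF this] obtain B where B: "\<forall>C\<in>\<C>. countable (B C) \<and> (\<forall>N\<in>B C. \<exists>V. openin X V \<and> N = C \<inter> V)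
    \<and> network_on X C (B C)" ..
  define \<N> where "\<N> = (\<Union>C\<in>\<C>. B C)"
  have cN: "countable \<N>" unfolding \<N>_def using C(1) B by simp
  have sub: "\<N> \<subseteq> Pow (topspace X)"
  proof
    fix N assume "N \<in> \<N>"
    then obtain D where "D \<in> \<C>" "N \<in> B D" by (auto simp: \<N>_def)
    then obtain V where "openin X V" "N = D \<inter> V" using B by blast
    then show "N \<in> Pow (topspace X)" using openin_subset by auto
  qed
  have base: "\<exists>N\<in>\<N>. y \<in> N \<and> N \<subseteq> U \<and> (\<exists>V. openin X V \<and> N = D \<inter> V)"
    if D: "D \<in> \<C>" "y \<in> D" and U: "openin X U" "y \<in> U" for D y U
  proof -
    have "network_on X D (B D)" using B D(1) by simp
    from network_onD[OF this D(2) U] obtain N where N: "N \<in> B D" "y \<in> N" "N \<subseteq> U" by auto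
    then have V: "\<exists>V. openin X V \<and> N = D \<inter> V" using B D(1) by simp
    have "N \<in> \<N>" using N(1) D(1) by (auto simp: \<N>_def)
    then show ?thesis by (intro bexI[of _ N] conjI V N(2,3))
  qed
  have "Pytkeev_network_at X \<N> x" if x: "x \<in> topspace X" for x
    unfolding Pytkeev_network_at_def network_at_def
  proof (intro conjI allI impI)
    obtain D where D: "D \<in> \<C>" "x \<in> D" using x C(3) by auto
    show "\<exists>N\<in>\<N>. x \<in> N \<and> N \<subseteq> U" if U: "openin X U \<and> x \<in> U" for U
      using base[OF D conjunct1[OF U] conjunct2[OF U]] by (elim bexE conjE) (intro bexI conjI)
  next
    fix U A assume A: "openin X U \<and> x \<in> U \<and> A \<subseteq> topspace X \<and> accumulates_at X A x"
    obtain V where V: "openin X V" "x \<in> V" "X closure_of V \<subseteq> U"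
      using regular_space_closure_subset[OF reg, of U x] A by auto
    have "\<exists>D\<in>\<C>. infinite (A \<inter> V \<inter> D)"
    proof (rule ccontr)
      assume "\<not> ?thesis"
      then have fin: "finite (A \<inter> V \<inter> D)" if "D \<in> \<C>" for D using that by auto
      \<comment> \<open>Finite traces on all pieces make \<open>E\<close> closed, and then \<open>V - E\<close> meets \<open>A\<close> at most in \<open>x\<close>.\<close>
      define E where "E = A \<inter> V - {x}"
      have "openin X (topspace X - E)"
      proof -
        have "openin (subtopology X D) (D \<inter> (topspace X - E))" if D: "D \<in> \<C>" for D
        proof -
          have "finite (D \<inter> E)" using fin[OF D] by (rule rev_finite_subset) (auto simp: E_def)
          then have "closedin X (D \<inter> E)" using t1 A unfolding E_def
            by (intro t1_space_closedin_finite[THEN iffD1, rule_format]) auto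
          then have "openin X (topspace X - D \<inter> E)" by blast
          moreover have "D \<inter> (topspace X - E) = D \<inter> (topspace X - D \<inter> E)" by auto
          ultimately show ?thesis by (simp add: openin_subtopology_Int2)
        qed
        then show ?thesis using k by simp
      qed
      then have "openin X (V \<inter> (topspace X - E))" using V(1) by (rule openin_Int[rotated])
      moreover have "x \<in> V \<inter> (topspace X - E)" using V(2) x by (simp add: E_def)
      ultimately have "infinite (V \<inter> (topspace X - E) \<inter> A)" using A unfolding accumulates_at_def by simp
      moreover have "finite (V \<inter> (topspace X - E) \<inter> A)"
        by (rule finite_subset[of _ "{x}"]) (auto simp: E_def)
      ultimately show False by simp
    qed
    then obtain D where D: "D \<in> \<C>" "infinite (A \<inter> V \<inter> D)" by auto
    obtain y where y: "y \<in> D" "accumulates_at X (A \<inter> V \<inter> D) y"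
      using compactin_infinite_accumulates[of X D "A \<inter> V \<inter> D"] C(2) D by auto
    have "y \<in> X closure_of V"
      unfolding in_closure_of
    proof (intro conjI allI impI)
      show "y \<in> topspace X" using y(1) D(1) C(3) by auto
      fix T assume "y \<in> T \<and> openin X T"
      then have "infinite (T \<inter> (A \<inter> V \<inter> D))" using y(2) unfolding accumulates_at_def by simp
      then have "T \<inter> (A \<inter> V \<inter> D) \<noteq> {}" by (rule contrapos_nn) simp
      then show "\<exists>z. z \<in> V \<and> z \<in> T" by auto
    qed
    then have "y \<in> U" using V(3) by auto
    from base[OF D(1) y(1) _ this] A obtain N where
      N: "N \<in> \<N>" "y \<in> N" "N \<subseteq> U" and "\<exists>W. openin X W \<and> N = D \<inter> W" by auto
    then obtain W where W: "openin X W" "N = D \<inter> W" by auto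
    then have "infinite (W \<inter> (A \<inter> V \<inter> D))" using y(2) N(2) unfolding accumulates_at_def by simp
    moreover have "W \<inter> (A \<inter> V \<inter> D) \<subseteq> N \<inter> A" using W(2) by auto
    ultimately have "infinite (N \<inter> A)" by (rule infinite_super[rotated])
    then show "\<exists>N\<in>\<N>. N \<subseteq> U \<and> infinite (N \<inter> A)" using N by auto
  qed (fact sub)
  then show ?thesis unfolding P0_space_def Pytkeev_network_def using T3 cN sub by auto
qed

section \<open>Metrics from countably many Urysohn functions\<close>

lemma countable_Urysohn_functions:
  assumes nor: "normal_space X" and cD: "countable \<D>"
  shows "\<exists>\<Phi>. countable \<Phi> \<and> (\<forall>f\<in>\<Phi>. continuous_map X euclideanreal f) \<and>
    (\<forall>N\<in>\<D>. \<forall>M\<in>\<D>. disjnt (X closure_of N) (X closure_of M) \<longrightarrow>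
      (\<exists>f\<in>\<Phi>. (\<forall>x\<in>X closure_of N. f x = (0::real)) \<and> (\<forall>x\<in>X closure_of M. f x = 1)))"
proof -
  define \<P> where "\<P> = {p \<in> \<D> \<times> \<D>. disjnt (X closure_of fst p) (X closure_of snd p)}"
  have "\<forall>p\<in>\<P>. \<exists>f. continuous_map X euclideanreal f \<and> (\<forall>x\<in>X closure_of fst p. f x = (0::real)) \<and>
      (\<forall>x\<in>X closure_of snd p. f x = 1)"
  proof
    fix p assume "p \<in> \<P>"
    then have dj: "disjnt (X closure_of fst p) (X closure_of snd p)" by (simp add: \<P>_def)
    obtain f where "continuous_map X (top_of_set {0..1::real}) f"
      "f ` (X closure_of fst p) \<subseteq> {0}" "f ` (X closure_of snd p) \<subseteq> {1}"
      by (rule Urysohn_lemma[OF nor closedin_closure_of closedin_closure_of dj, of 0 1]) auto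
    then show "\<exists>f. continuous_map X euclideanreal f \<and> (\<forall>x\<in>X closure_of fst p. f x = (0::real)) \<and>
      (\<forall>x\<in>X closure_of snd p. f x = 1)"
      by (intro exI[of _ f]) (auto simp: continuous_map_in_subtopology)
  qed
  from bchoice[OF this] obtain F where F: "\<forall>p\<in>\<P>. continuous_map X euclideanreal (F p) \<and>
      (\<forall>x\<in>X closure_of fst p. F p x = (0::real)) \<and> (\<forall>x\<in>X closure_of snd p. F p x = 1)" ..
  show ?thesis
  proof (intro exI[of _ "F ` \<P>"] conjI ballI impI)
    have "countable (\<D> \<times> \<D>)" using cD by simp
    then show "countable (F ` \<P>)" unfolding \<P>_def by (intro countable_image countable_Collect)
    show "continuous_map X euclideanreal f" if "f \<in> F ` \<P>" for f using that F by auto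
    fix N M assume NM: "N \<in> \<D>" "M \<in> \<D>" "disjnt (X closure_of N) (X closure_of M)"
    then have p: "(N, M) \<in> \<P>" by (simp add: \<P>_def)
    then show "\<exists>f\<in>F ` \<P>. (\<forall>x\<in>X closure_of N. f x = (0::real)) \<and> (\<forall>x\<in>X closure_of M. f x = 1)"
      using F[rule_format, OF p] by (intro bexI[of _ "F (N, M)"]) simp_all
  qed
qed

lemma continuous_map_evaluation:
  assumes "\<And>f. f \<in> \<Phi> \<Longrightarrow> continuous_map X euclideanreal f"
  shows "continuous_map X (product_topology (\<lambda>_. euclideanreal) \<Phi>) (\<lambda>x. \<lambda>f\<in>\<Phi>. f x)"
  unfolding continuous_map_componentwise using assms by (auto simp: extensional_def cong: restrict_cong)

lemma evaluation_inj_on: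
  assumes "\<And>x y. \<lbrakk>x \<in> S; y \<in> S; x \<noteq> y\<rbrakk> \<Longrightarrow> \<exists>f\<in>\<Phi>. f x \<noteq> f y"
  shows "inj_on (\<lambda>x. \<lambda>f\<in>\<Phi>. f x) S"
proof (rule inj_onI, rule ccontr)
  fix x y assume xy: "x \<in> S" "y \<in> S" "(\<lambda>f\<in>\<Phi>. f x) = (\<lambda>f\<in>\<Phi>. f y)" "x \<noteq> y"
  then obtain f where "f \<in> \<Phi>" "f x \<noteq> f y" using assms by auto
  then show False using fun_cong[OF xy(3), of f] by simp
qed

lemma metrizable_real_power:
  "countable \<Phi> \<Longrightarrow> metrizable_space (product_topology (\<lambda>_. euclideanreal) \<Phi>)"
  unfolding metrizable_space_product_topology
  by (intro disjI2 conjI ballI metrizable_space_euclidean countable_Collect)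

text \<open>
  The evaluation map into a countable power of the reals is injective, and a metric of the power pulls back.
\<close>

lemma submetrizable_if_separating_functions:
  assumes c: "countable \<Phi>" and cont: "\<And>f. f \<in> \<Phi> \<Longrightarrow> continuous_map X euclideanreal f"
    and sep: "\<And>x y. \<lbrakk>x \<in> topspace X; y \<in> topspace X; x \<noteq> y\<rbrakk> \<Longrightarrow> \<exists>f\<in>\<Phi>. f x \<noteq> f y"
  shows "submetrizable_space X"
proof -
  define E where "E x = (\<lambda>f\<in>\<Phi>. f x)" for x
  define Y where "Y = product_topology (\<lambda>_. euclideanreal) \<Phi>"
  have E: "continuous_map X Y E" unfolding Y_def E_def using cont by (rule continuous_map_evaluation)
  have inj: "inj_on E (topspace X)" unfolding E_def using sep by (rule evaluation_inj_on)
  obtain M d where M: "Metric_space M d" and Y: "Y = Metric_space.mtopology M d"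
    using metrizable_real_power[OF c] unfolding metrizable_space_def Y_def by auto
  interpret Metric_space M d by (rule M)
  have EM: "E x \<in> M" if "x \<in> topspace X" for x
    using E that unfolding Y by (auto simp: continuous_map_def Pi_iff)
  have "Metric_space (topspace X) (\<lambda>x y. d (E x) (E y))"
  proof
    show "d (E x) (E y) = d (E y) (E x)" for x y by (rule commute)
    show "(d (E x) (E y) = 0) = (x = y)" if "x \<in> topspace X" "y \<in> topspace X" for x y
      using inj_on_eq_iff[OF inj that] EM that by simp
    show "d (E x) (E z) \<le> d (E x) (E y) + d (E y) (E z)"
      if "x \<in> topspace X" "y \<in> topspace X" "z \<in> topspace X" for x y z
      using triangle EM that by simp
  qed simp
  moreover have "continuous_map (prod_topology X X) euclideanreal (\<lambda>(x, y). d (E x) (E y))"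
  proof -
    let ?m = "metric (M, d)"
    have "continuous_map (prod_topology X X) (mtopology_of ?m) (E \<circ> fst)"
      "continuous_map (prod_topology X X) (mtopology_of ?m) (E \<circ> snd)"
      using continuous_map_compose[OF continuous_map_fst E] continuous_map_compose[OF continuous_map_snd E]
      by (simp_all add: Y)
    from continuous_map_mdist[OF this] show ?thesis by (simp add: o_def case_prod_unfold)
  qed
  ultimately show ?thesis unfolding submetrizable_space_def by (intro exI[of _ "\<lambda>x y. d (E x) (E y)"] conjI)
qed

text \<open>
  Functions that also separate points from closed sets make the evaluation map open onto its image.
\<close>

lemma metrizable_if_separating_functions:
  assumes c: "countable \<Phi>" and cont: "\<And>f. f \<in> \<Phi> \<Longrightarrow> continuous_map X euclideanreal f"
    and sep: "\<And>x y. \<lbrakk>x \<in> topspace X; y \<in> topspace X; x \<noteq> y\<rbrakk> \<Longrightarrow> \<exists>f\<in>\<Phi>. f x \<noteq> f y"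
    and sep': "\<And>x U. \<lbrakk>openin X U; x \<in> U\<rbrakk> \<Longrightarrow> \<exists>f\<in>\<Phi>. f x = 0 \<and> (\<forall>y\<in>topspace X - U. f y = 1)"
  shows "metrizable_space X"
proof -
  define E where "E x = (\<lambda>f\<in>\<Phi>. f x)" for x
  define Y where "Y = product_topology (\<lambda>_. euclideanreal) \<Phi>"
  have E: "continuous_map X Y E" unfolding Y_def E_def using cont by (rule continuous_map_evaluation)
  have inj: "inj_on E (topspace X)" unfolding E_def using sep by (rule evaluation_inj_on)
  have sub: "E ` topspace X \<subseteq> topspace Y" using E by (auto simp: continuous_map_def Pi_iff)
  let ?Z = "subtopology Y (E ` topspace X)"
  have "open_map X ?Z E"
    unfolding open_map_def
  proof (intro allI impI)
    fix U assume U: "openin X U"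
    have "\<exists>T. openin ?Z T \<and> y \<in> T \<and> T \<subseteq> E ` U" if y: "y \<in> E ` U" for y
    proof -
      obtain x where x: "x \<in> U" "y = E x" using y by auto
      from sep'[OF U x(1)] obtain f where f: "f \<in> \<Phi>" "f x = 0" "\<forall>z\<in>topspace X - U. f z = 1" by auto
      define W where "W = {g \<in> topspace Y. g f \<in> {..<1}}"
      have "continuous_map Y euclideanreal (\<lambda>g. g f)"
        unfolding Y_def using f(1) by (rule continuous_map_product_projection)
      then have W: "openin Y W" unfolding W_def by (rule openin_continuous_map_preimage) simp
      have "x \<in> topspace X" using x(1) openin_subset[OF U] by auto
      then have "y \<in> W" using x(2) f(1,2) sub by (auto simp: W_def E_def)
      moreover have "y \<in> E ` topspace X" using x openin_subset[OF U] by auto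
      moreover have "E ` topspace X \<inter> W \<subseteq> E ` U"
      proof
        fix g assume g: "g \<in> E ` topspace X \<inter> W"
        then obtain z where z: "z \<in> topspace X" "g = E z" by auto
        have "z \<in> U"
        proof (rule ccontr)
          assume "z \<notin> U"
          then have "f z = 1" using f(3) z(1) by simp
          then show False using g z(2) f(1) by (simp add: W_def E_def)
        qed
        then show "g \<in> E ` U" using z(2) by simp
      qed
      moreover have "openin ?Z (E ` topspace X \<inter> W)" using W by (rule openin_subtopology_Int2)
      ultimately show ?thesis by (intro exI[of _ "E ` topspace X \<inter> W"]) simp
    qed
    then show "openin ?Z (E ` U)" by (subst openin_subopen) simp
  qed
  moreover have "continuous_map X ?Z E" using E by (rule continuous_map_into_subtopology) simp
  moreover have "E ` topspace X = topspace ?Z" using sub by auto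
  ultimately have "homeomorphic_map X ?Z E" using inj by (intro bijective_open_imp_homeomorphic_map)
  then have "X homeomorphic_space ?Z" by (rule homeomorphic_map_imp_homeomorphic_space)
  moreover have "metrizable_space ?Z"
    unfolding Y_def by (rule metrizable_space_subtopology[OF metrizable_real_power[OF c]])
  ultimately show ?thesis using homeomorphic_metrizable_space by metis
qed

text \<open>
  Distinct points lie in network elements with disjoint closures, so Urysohn functions for the countably many
  such pairs separate points.
\<close>

lemma network_imp_submetrizable:
  assumes reg: "regular_space X" and H: "Hausdorff_space X" and cD: "countable \<D>"
    and net: "network_on X (topspace X) \<D>"
  shows "submetrizable_space X"
proof -
  have "normal_space X"
    using regular_Lindelof_imp_normal_space[OF reg network_imp_Lindelof[OF cD net]] .
  from countable_Urysohn_functions[OF this cD] obtain \<Phi> where \<Phi>: "countable \<Phi>"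
    "\<forall>f\<in>\<Phi>. continuous_map X euclideanreal f"
    and ury: "\<forall>N\<in>\<D>. \<forall>M\<in>\<D>. disjnt (X closure_of N) (X closure_of M) \<longrightarrow>
      (\<exists>f\<in>\<Phi>. (\<forall>x\<in>X closure_of N. f x = (0::real)) \<and> (\<forall>x\<in>X closure_of M. f x = 1))" by (elim exE conjE)
  have inner: "\<exists>N\<in>\<D>. x \<in> X closure_of N \<and> X closure_of N \<subseteq> U" if U: "openin X U" "x \<in> U" for x U
  proof -
    obtain V where V: "openin X V" "x \<in> V" "X closure_of V \<subseteq> U" using regular_space_closure_subset[OF reg U] by metis
    have x: "x \<in> topspace X" using U openin_subset by auto
    from network_onD[OF net x V(1,2)] obtain N where N: "N \<in> \<D>" "x \<in> N" "N \<subseteq> V" by auto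
    have "X closure_of N \<subseteq> U" using closure_of_mono[OF N(3), of X] V(3) by simp
    moreover have "x \<in> X closure_of N" using N(2) x by (auto simp: in_closure_of)
    ultimately show ?thesis using N(1) by (intro bexI[of _ N] conjI)
  qed
  have "\<exists>f\<in>\<Phi>. f x \<noteq> f y" if xy: "x \<in> topspace X" "y \<in> topspace X" "x \<noteq> y" for x y
  proof -
    obtain U V where UV: "openin X U" "openin X V" "x \<in> U" "y \<in> V" "disjnt U V"
      using H xy unfolding Hausdorff_space_def by metis
    from inner[OF UV(1,3)] obtain N where N: "N \<in> \<D>" "x \<in> X closure_of N" "X closure_of N \<subseteq> U" by auto
    from inner[OF UV(2,4)] obtain M where M: "M \<in> \<D>" "y \<in> X closure_of M" "X closure_of M \<subseteq> V" by auto
    have "disjnt (X closure_of N) (X closure_of M)" using N(3) M(3) UV(5) by (auto simp: disjnt_iff)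
    from ury[rule_format, OF N(1) M(1) this] obtain f where
      "f \<in> \<Phi>" "\<forall>x\<in>X closure_of N. f x = 0" "\<forall>x\<in>X closure_of M. f x = 1" by auto
    then show ?thesis using N(2) M(2) by (intro bexI[of _ f]) simp_all
  qed
  then show ?thesis using submetrizable_if_separating_functions[OF \<Phi>(1)] \<Phi>(2) by simp
qed

text \<open>
  Urysohn's metrization theorem. The complements of basic sets are added to the base so that pairs of disjoint
  closures include a basic closure and the complement of a larger basic set.
\<close>

lemma second_countable_imp_metrizable:
  assumes reg: "regular_space X" and H: "Hausdorff_space X" and sc: "second_countable X"
  shows "metrizable_space X"
proof -
  obtain \<B> where B: "countable \<B>" "\<forall>V\<in>\<B>. openin X V"
    and base: "\<forall>U x. openin X U \<and> x \<in> U \<longrightarrow> (\<exists>V\<in>\<B>. x \<in> V \<and> V \<subseteq> U)"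
    using sc unfolding second_countable_def by (elim exE conjE)
  have nor: "normal_space X"
    using regular_Lindelof_imp_normal_space[OF reg second_countable_imp_Lindelof_space[OF sc]] .
  have "countable (\<B> \<union> (\<lambda>V. topspace X - V) ` \<B>)" using B(1) by simp
  from countable_Urysohn_functions[OF nor this] obtain \<Phi> where \<Phi>: "countable \<Phi>" "\<forall>f\<in>\<Phi>. continuous_map X euclideanreal f"
    and ury: "\<forall>N\<in>\<B> \<union> (\<lambda>V. topspace X - V) ` \<B>. \<forall>M\<in>\<B> \<union> (\<lambda>V. topspace X - V) ` \<B>.
      disjnt (X closure_of N) (X closure_of M) \<longrightarrow>
      (\<exists>f\<in>\<Phi>. (\<forall>x\<in>X closure_of N. f x = (0::real)) \<and> (\<forall>x\<in>X closure_of M. f x = 1))"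
    by (elim exE conjE)
  have sep': "\<exists>f\<in>\<Phi>. f x = 0 \<and> (\<forall>y\<in>topspace X - U. f y = 1)" if U: "openin X U" "x \<in> U" for x U
  proof -
    obtain M where M: "M \<in> \<B>" "x \<in> M" "M \<subseteq> U" using base U by metis
    have opM: "openin X M" using B(2) M(1) by simp
    obtain W where W: "openin X W" "x \<in> W" "X closure_of W \<subseteq> M"
      using regular_space_closure_subset[OF reg opM M(2)] by metis
    obtain N where N: "N \<in> \<B>" "x \<in> N" "N \<subseteq> W" using base W by metis
    have clM: "X closure_of (topspace X - M) = topspace X - M"
      using opM by (simp add: closure_of_eq closedin_diff)
    have clN: "X closure_of N \<subseteq> M" using closure_of_mono[OF N(3), of X] W(3) by simp
    have mem: "N \<in> \<B> \<union> (\<lambda>V. topspace X - V) ` \<B>" "topspace X - M \<in> \<B> \<union> (\<lambda>V. topspace X - V) ` \<B>"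
      using N(1) M(1) by auto
    have "disjnt (X closure_of N) (X closure_of (topspace X - M))"
      unfolding clM using clN by (auto simp: disjnt_iff)
    from ury[rule_format, OF mem this] obtain f where f: "f \<in> \<Phi>" "\<forall>x\<in>X closure_of N. f x = 0"
      "\<forall>x\<in>X closure_of (topspace X - M). f x = 1" by (elim bexE conjE)
    have "x \<in> X closure_of N" using N(2) openin_subset[OF U(1)] U(2) by (auto simp: in_closure_of)
    then have "f x = 0" using f(2) by simp
    moreover have "\<forall>y\<in>topspace X - U. f y = 1" using f(3) M(3) unfolding clM by auto
    ultimately show ?thesis using f(1) by (intro bexI[of _ f] conjI)
  qed
  have sep: "\<exists>f\<in>\<Phi>. f x \<noteq> f y" if xy: "x \<in> topspace X" "y \<in> topspace X" "x \<noteq> y" for x y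
  proof -
    obtain U V where UV: "openin X U" "openin X V" "x \<in> U" "y \<in> V" "disjnt U V"
      using H xy unfolding Hausdorff_space_def by metis
    from sep'[OF UV(1,3)] obtain f where f: "f \<in> \<Phi>" "f x = 0" "\<forall>y\<in>topspace X - U. f y = 1" by auto
    have "y \<in> topspace X - U" using UV(4,5) xy(2) by (auto simp: disjnt_iff)
    then show ?thesis using f by (intro bexI[of _ f]) simp_all
  qed
  show ?thesis by (rule metrizable_if_separating_functions[OF \<Phi>(1) _ sep sep']) (use \<Phi>(2) in auto)
qed

section \<open>The equivalences\<close>

context sequential_rectifiable
begin

lemma T3_space: "T3_space X"
  unfolding T3_space_def using regular_space Hausdorff Hausdorff_imp_t1_space by auto

text \<open>
  For \<open>x \<notin> D\<close> the quotients \<open>ldiv d x\<close> with \<open>d \<in> D\<close> close to \<open>x\<close> accumulate at \<open>e\<close>, so a small Pytkeev element \<open>N\<close>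
  contains one of them, and then \<open>x \<in> d \<cdot> N\<close>. For \<open>x \<in> D\<close> all quotients that matter may equal \<open>e\<close>, and a
  network element containing \<open>e\<close> is used with \<open>d = x\<close>.
\<close>

lemma separable_strong_Pytkeev_imp_network:
  assumes sep: "separable_space X" and pyt: "strong_Pytkeev_property X"
  shows "\<exists>\<D>. countable \<D> \<and> network_on X (topspace X) \<D>"
proof -
  obtain D where D: "countable D" "D \<subseteq> topspace X" "X closure_of D = topspace X"
    using sep unfolding separable_space_def by auto
  obtain \<N> where cN: "countable \<N>" and N: "Pytkeev_network_at X \<N> e"
    using pyt[unfolded strong_Pytkeev_property_def, THEN bspec, OF e_in] by auto
  have net: "network_at X \<N> e" using N by (simp add: Pytkeev_network_at_def)
  have NX: "M \<subseteq> topspace X" if "M \<in> \<N>" for M using net that by (auto simp: network_at_def)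
  define \<D> where "\<D> = (\<lambda>(d, M). (\<lambda>m. d \<cdot> m) ` M) ` (D \<times> \<N>)"
  have "countable \<D>" unfolding \<D>_def using D(1) cN by simp
  moreover have "network_on X (topspace X) \<D>"
    unfolding network_on_def
  proof (intro ballI allI impI)
    fix x U assume x: "x \<in> topspace X" and U: "openin X U" "x \<in> U"
    obtain W V where WV: "openin X W" "openin X V" "x \<in> W" "e \<in> V" "\<forall>v\<in>W. \<forall>w\<in>V. v \<cdot> w \<in> U"
      using mul_open_nbhds[of U x e] x U by auto
    have goal: "\<exists>N\<in>\<D>. x \<in> N \<and> N \<subseteq> U" if d: "d \<in> D" "d \<in> W" and M: "M \<in> \<N>" "M \<subseteq> V" "ldiv d x \<in> M" for d M
    proof -
      have "x \<in> (\<lambda>m. d \<cdot> m) ` M" using M(3) d(1) D(2) x by (intro image_eqI[of _ _ "ldiv d x"]) auto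
      moreover have "(\<lambda>m. d \<cdot> m) ` M \<subseteq> U" using WV(5) d(2) M(2) by auto
      moreover have "(\<lambda>m. d \<cdot> m) ` M \<in> \<D>" unfolding \<D>_def using d(1) M(1) by (intro image_eqI[of _ _ "(d, M)"]) auto
      ultimately show ?thesis by (intro bexI[of _ "(\<lambda>m. d \<cdot> m) ` M"] conjI)
    qed
    show "\<exists>N\<in>\<D>. x \<in> N \<and> N \<subseteq> U"
    proof (cases "x \<in> D")
      case True
      obtain M where "M \<in> \<N>" "e \<in> M" "M \<subseteq> V" using net WV(2,4) unfolding network_at_def by auto
      then show ?thesis using goal[OF True WV(3)] x by simp
    next
      case False
      define A where "A = (\<lambda>d. ldiv d x) ` (D \<inter> W)"
      have AX: "A \<subseteq> topspace X" unfolding A_def using D(2) x by auto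
      have eA: "e \<notin> A"
      proof
        assume "e \<in> A"
        then obtain d where d: "d \<in> D" "ldiv d x = e" unfolding A_def by auto
        have dX: "d \<in> topspace X" using d(1) D(2) by auto
        have "d \<cdot> ldiv d x = d" unfolding d(2) using dX by simp
        then have "d = x" using mul_ldiv[OF dX x] by simp
        then show False using d(1) False by simp
      qed
      have meet: "T \<inter> A \<noteq> {}" if T: "openin X T" "e \<in> T" for T
      proof -
        have "openin X (W \<inter> {y \<in> topspace X. ldiv y x \<in> T})"
          by (intro openin_Int WV(1) openin_ldiv_left T(1) x)
        moreover have "x \<in> W \<inter> {y \<in> topspace X. ldiv y x \<in> T}" using WV(3) x T(2) by simp
        moreover have "x \<in> X closure_of D" using D(3) x by simp
        ultimately obtain d where "d \<in> D" "d \<in> W \<inter> {y \<in> topspace X. ldiv y x \<in> T}"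
          unfolding in_closure_of by metis
        then have "ldiv d x \<in> T \<inter> A" unfolding A_def by simp
        then show ?thesis by (metis empty_iff)
      qed
      have "accumulates_at X A e"
        unfolding accumulates_at_def
      proof (intro allI impI notI)
        fix T assume T: "openin X T \<and> e \<in> T" and fin: "finite (T \<inter> A)"
        have "closedin X (T \<inter> A)"
          using T3_space fin AX by (intro t1_space_closedin_finite[THEN iffD1, rule_format]) (auto simp: T3_space_def)
        then have "openin X (T - (T \<inter> A))" using T by (intro openin_diff) auto
        from meet[OF this] show False using T eA by auto
      qed
      then have "\<exists>N\<in>\<N>. N \<subseteq> V \<and> infinite (N \<inter> A)"
        using N WV(2,4) AX unfolding Pytkeev_network_at_def by simp
      then obtain M where M: "M \<in> \<N>" "M \<subseteq> V" "infinite (M \<inter> A)" by auto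
      then have "M \<inter> A \<noteq> {}" by (intro notI) simp
      then obtain d where "d \<in> D" "d \<in> W" "ldiv d x \<in> M" unfolding A_def by auto
      then show ?thesis using goal M(1,2) by simp
    qed
  qed
  ultimately show ?thesis by auto
qed

lemma nbhd_base_e_if_metrizable:
  assumes "metrizable_space X"
  shows "\<exists>\<V>. nbhd_base_e \<V>"
proof -
  obtain \<B> where B: "countable \<B>" "\<forall>V\<in>\<B>. openin X V"
    "\<forall>U. openin X U \<and> e \<in> U \<longrightarrow> (\<exists>V\<in>\<B>. e \<in> V \<and> V \<subseteq> U)"
    using metrizable_imp_first_countable[OF assms] e_in unfolding first_countable_def by metis
  then have "nbhd_base_e {V\<in>\<B>. e \<in> V}" unfolding nbhd_base_e_def by auto
  then show ?thesis by auto
qed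

lemma separable_metrizable_imp_P0:
  assumes "metrizable_space X" "separable_space X"
  shows "P0_space X"
  using nbhd_base_e_if_metrizable[OF assms(1)] separable_imp_second_countable[OF assms(2)]
    second_countable_imp_P0[OF T3_space] by auto

lemma Lindelof_cs_star_dichotomy:
  assumes Lin: "Lindelof_space X" and cs: "countable_cs_star_character X"
  shows "(metrizable_space X \<and> separable_space X) \<or> (submetrizable_space X \<and> k_omega_space X)"
proof -
  obtain \<N> where "countable \<N>" "cs_star_network_at X \<N> e"
    using cs[unfolded countable_cs_star_character_def, THEN bspec, OF e_in] by auto
  from closed_cs_star_exists[OF regular_space this] obtain \<C> where C: "closed_cs_star X e \<C>" by auto
  from capturing_or_metric_fan[OF C e_in] show ?thesis
  proof (elim disjE exE conjE)
    fix \<K> assume K: "countable \<K>" "\<forall>K\<in>\<K>. seq_compactin X K"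
      "\<forall>s. limitin X s e sequentially \<longrightarrow> (\<exists>K\<in>\<K>. eventually (\<lambda>n. s n \<in> K) sequentially)"
    have "k_omega_space X \<and> (\<exists>\<D>. countable \<D> \<and> network_on X (topspace X) \<D>)"
      by (rule k_omega_and_network[OF Lin C K(1)]) (use K(2,3) in simp_all)
    then show ?thesis using network_imp_submetrizable[OF regular_space Hausdorff] by auto
  next
    fix a assume "metric_fan X e a"
    from metric_fan_imp_crossing_property[OF Lin this] crossing_imp_nbhd_base[OF _ C]
    obtain \<V> where V: "nbhd_base_e \<V>" by auto
    have sep: "separable_space X" by (rule Lindelof_imp_separable[OF Lin V])
    then have "metrizable_space X"
      by (intro second_countable_imp_metrizable[OF regular_space Hausdorff] separable_imp_second_countable[OF _ V])
    with sep show ?thesis by simp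
  qed
qed

end

theorem theorem5p3:
  fixes X :: "'a topology"
  assumes "sequential_space X" and "rectifiable_space X" and "t0_space X"
  shows "(P0_space X \<longleftrightarrow> aleph0_space X) \<and>
         (aleph0_space X \<longleftrightarrow> Lindelof_space X \<and> countable_cs_star_character X) \<and>
         (Lindelof_space X \<and> countable_cs_star_character X \<longleftrightarrow>
            separable_space X \<and> strong_Pytkeev_property X) \<and>
         (separable_space X \<and> strong_Pytkeev_property X \<longleftrightarrow>
            (metrizable_space X \<and> separable_space X) \<or>
            (submetrizable_space X \<and> k_omega_space X))"
proof -
  obtain e mul ldiv where ops: "rectifiable_operations X e mul ldiv"
    using rectifiable_space_imp_operations[OF assms(2)] by auto
  interpret rectifiable_operations X e mul ldiv by (rule ops)
  interpret sequential_rectifiable X e mul ldiv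
    using assms(1) regular_t0_imp_Hausdorff_space[OF regular_space assms(3)] by unfold_locales
  have P0_aleph0: "P0_space X \<Longrightarrow> aleph0_space X" by (rule P0_imp_aleph0)
  have aleph0_cs: "aleph0_space X \<Longrightarrow> Lindelof_space X \<and> countable_cs_star_character X"
    by (rule aleph0_imp_Lindelof_cs_star)
  have cs_sum: "Lindelof_space X \<and> countable_cs_star_character X \<Longrightarrow>
      (metrizable_space X \<and> separable_space X) \<or> (submetrizable_space X \<and> k_omega_space X)"
    using Lindelof_cs_star_dichotomy by simp
  have sum_P0: "(metrizable_space X \<and> separable_space X) \<or> (submetrizable_space X \<and> k_omega_space X)
      \<Longrightarrow> P0_space X"
    using separable_metrizable_imp_P0 submetrizable_k_omega_imp_P0[OF T3_space] by auto
  have P0_Pyt: "P0_space X \<Longrightarrow> separable_space X \<and> strong_Pytkeev_property X"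
    by (rule P0_imp_separable_strong_Pytkeev)
  have Pyt_cs: "Lindelof_space X \<and> countable_cs_star_character X"
    if sP: "separable_space X \<and> strong_Pytkeev_property X"
  proof
    show "Lindelof_space X"
      using sP separable_strong_Pytkeev_imp_network network_imp_Lindelof by auto
    show "countable_cs_star_character X"
      unfolding countable_cs_star_character_def
    proof
      fix x assume x: "x \<in> topspace X"
      obtain \<N> where "countable \<N>" "Pytkeev_network_at X \<N> x"
        using sP[THEN conjunct2, unfolded strong_Pytkeev_property_def, THEN bspec, OF x] by auto
      then show "\<exists>\<N>. countable \<N> \<and> cs_star_network_at X \<N> x"
        using Pytkeev_imp_cs_star_network_at[OF Hausdorff] by auto
    qed
  qed
  show ?thesis using P0_aleph0 aleph0_cs cs_sum sum_P0 P0_Pyt Pyt_cs by argo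
qed

end
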